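(* Let $J \subset \mathbf{E}^2$ be a Jordan domain with Euclidean diameter $D$, and let $X \subseteq J$ be its set of finite-distance points, equipped with the length metric $d$. Then $(X,d)$ is $\frac{\sqrt{3}}{4}D$-hyperbolic.
   Context: A Jordan domain $J$ is a subset of the Euclidean plane $\mathbf{E}^2$ that is the homeomorphic image of a closed disk; its boundary $\partial J$ is the image of the boundary circle (a Jordan curve), and its interior is the bounded component of the complement of that curve. The set $X$ of finite-distance points of $J$ consists of all interior points of $J$ together with those points of $\partial J$ that can be connected to some (equivalently, every) interior point by a curve in $J$ of finite Euclidean length. The length metric on $X$ is $d(x,y) = $ the infimum of the Euclidean lengths of curves in $J$ joining $x$ to $y$. A geodesic triangle in a metric space consists of three shortest curves (its sides) connecting a triple of points (its vertices). A geodesic metric space is $\delta$-hyperbolic, where $\delta \ge 0$, if for every geodesic triangle the distance from any point on one side of the triangle to the union of the other two sides is $\le \delta$. *)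

theory Defs
  imports "HOL-Analysis.Analysis"
begin

section \<open>Length, geodesics and hyperbolicity in metric spaces\<close>

text \<open>Curves are parametrised by \<open>{0..1}\<close>. The length is the supremum, over all finite
  sequences \<open>t\<^sub>0 \<le> \<dots> \<le> t\<^sub>n\<close> in \<open>{0..1}\<close>, of the lengths of the inscribed polygons;
  it may be infinite.\<close>

definition curve_length :: "('a \<Rightarrow> 'a \<Rightarrow> real) \<Rightarrow> (real \<Rightarrow> 'a) \<Rightarrow> ennreal" where
  "curve_length d g =
     (SUP ts \<in> {ts. sorted ts \<and> set ts \<subseteq> {0..1}}.
        \<Sum>i<length ts - 1. ennreal (d (g (ts ! i)) (g (ts ! Suc i))))"

definition curve_between ::
  "'a set \<Rightarrow> ('a \<Rightarrow> 'a \<Rightarrow> real) \<Rightarrow> 'a \<Rightarrow> 'a \<Rightarrow> (real \<Rightarrow> 'a) \<Rightarrow> bool" where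
  "curve_between M d x y g \<longleftrightarrow>
     pathin (Metric_space.mtopology M d) g \<and> g 0 = x \<and> g 1 = y"

definition shortest_curve ::
  "'a set \<Rightarrow> ('a \<Rightarrow> 'a \<Rightarrow> real) \<Rightarrow> 'a \<Rightarrow> 'a \<Rightarrow> (real \<Rightarrow> 'a) \<Rightarrow> bool" where
  "shortest_curve M d x y g \<longleftrightarrow>
     curve_between M d x y g \<and>
     (\<forall>h. curve_between M d x y h \<longrightarrow> curve_length d g \<le> curve_length d h)"

definition geodesic_metric_space :: "'a set \<Rightarrow> ('a \<Rightarrow> 'a \<Rightarrow> real) \<Rightarrow> bool" where
  "geodesic_metric_space M d \<longleftrightarrow>
     Metric_space M d \<and>
     (\<forall>x\<in>M. \<forall>y\<in>M. \<exists>g. curve_between M d x y g \<and> curve_length d g = ennreal (d x y))"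

definition geodesic_triangle ::
  "'a set \<Rightarrow> ('a \<Rightarrow> 'a \<Rightarrow> real) \<Rightarrow> (real \<Rightarrow> 'a) \<Rightarrow> (real \<Rightarrow> 'a) \<Rightarrow> (real \<Rightarrow> 'a) \<Rightarrow> bool" where
  "geodesic_triangle M d a b c \<longleftrightarrow>
     (\<exists>x\<in>M. \<exists>y\<in>M. \<exists>z\<in>M.
        shortest_curve M d x y a \<and> shortest_curve M d y z b \<and> shortest_curve M d z x c)"

definition side_within ::
  "('a \<Rightarrow> 'a \<Rightarrow> real) \<Rightarrow> real \<Rightarrow> (real \<Rightarrow> 'a) \<Rightarrow> (real \<Rightarrow> 'a) \<Rightarrow> (real \<Rightarrow> 'a) \<Rightarrow> bool" where
  "side_within d \<delta> a b c \<longleftrightarrow>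
     (\<forall>p \<in> a ` {0..1}. (INF q \<in> b ` {0..1} \<union> c ` {0..1}. d p q) \<le> \<delta>)"

definition hyperbolic_space :: "'a set \<Rightarrow> ('a \<Rightarrow> 'a \<Rightarrow> real) \<Rightarrow> real \<Rightarrow> bool" where
  "hyperbolic_space M d \<delta> \<longleftrightarrow>
     geodesic_metric_space M d \<and> 0 \<le> \<delta> \<and>
     (\<forall>a b c. geodesic_triangle M d a b c \<longrightarrow>
        side_within d \<delta> a b c \<and> side_within d \<delta> b c a \<and> side_within d \<delta> c a b)"

section \<open>Jordan domains and their finite-distance points\<close>

definition jordan_domain :: "(real^2) set \<Rightarrow> bool" where
  "jordan_domain J \<longleftrightarrow> J homeomorphic (cball 0 1 :: (real^2) set)"

text \<open>The image of the unit circle does not depend on the homeomorphism from the disk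
  (invariance of domain), so the union over all homeomorphisms is the image under any one.\<close>

definition jordan_boundary :: "(real^2) set \<Rightarrow> (real^2) set" where
  "jordan_boundary J =
     {p. \<exists>h k. homeomorphism (cball 0 1 :: (real^2) set) J h k \<and> p \<in> h ` sphere 0 1}"

definition jordan_interior :: "(real^2) set \<Rightarrow> (real^2) set" where
  "jordan_interior J = inside (jordan_boundary J)"

definition euclidean_curve_in ::
  "(real^2) set \<Rightarrow> real^2 \<Rightarrow> real^2 \<Rightarrow> (real \<Rightarrow> real^2) \<Rightarrow> bool" where
  "euclidean_curve_in J x y g \<longleftrightarrow>
     path g \<and> path_image g \<subseteq> J \<and> pathstart g = x \<and> pathfinish g = y"

definition finite_distance_points :: "(real^2) set \<Rightarrow> (real^2) set" where
  "finite_distance_points J =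
     jordan_interior J \<union>
     {p \<in> jordan_boundary J. \<exists>q \<in> jordan_interior J. \<exists>g.
        euclidean_curve_in J q p g \<and> curve_length dist g < \<infinity>}"

text \<open>The infimum is finite for finite-distance points; elsewhere \<^const>\<open>enn2real\<close> maps
  an infinite infimum to \<open>0\<close>.\<close>

definition length_metric :: "(real^2) set \<Rightarrow> real^2 \<Rightarrow> real^2 \<Rightarrow> real" where
  "length_metric J x y =
     enn2real (INF g \<in> {g. euclidean_curve_in J x y g}. curve_length dist g)"

end

theory Submission
  imports Defs "HOL-Complex_Analysis.Great_Picard"
begin

text \<open>Why the theorem is true. In a domain without holes, a region enclosed by shortest curves lies in the
domain, so a chord of the region is a possible shortcut. Therefore a chord never has both ends on the
same shortest curve (\<open>chord_separates\<close>), and this one remark carries all of the geometry: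

\<^item> The hull of a Jordan curve made of shortest arcs has only the corners as extreme points
  (\<open>extreme_point_in_two\<close>, \<open>Jordan_curve_in_hull_of_corners\<close>). There are no bigons, so shortest curves
  are unique (\<open>taut_path_within\<close>), and the sides of a triangle bend into the Euclidean triangle of its
  corners.

\<^item> Through each point enclosed by a triangle with sides \<open>\<alpha>\<close>, \<open>\<beta>\<close>, \<open>\<gamma>\<close> there is a chord from \<open>\<beta>\<close> to \<open>\<gamma>\<close>, by
  connectedness of the circle of directions (\<open>chord_between_other_sides\<close>). In the limit this holds for a
  point \<open>p\<close> of the side \<open>\<alpha>\<close> itself.

Now let \<open>p\<close> be a point of one side, not on the two others. The chord through \<open>p\<close> cuts off a triangle with
one straight side through \<open>p\<close> whose two other sides bend inwards. Walking from \<open>p\<close> straight towards the other sides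
of the Euclidean triangle one meets the bent sides first (\<open>straight_triangle\<close>). So the claim follows
from the bound for Euclidean triangles whose sides are at most the diameter \<open>D\<close> of \<open>J\<close>: a point of a
side has distance at most \<open>sqrt 3 / 4 * D\<close> from the two others (\<open>triangle_bound\<close>), the extremal
case being the midpoint in the equilateral triangle.

It remains to see that shortest curves exist and are taut in the sense used above. Curves of
bounded length are handled through Lipschitz parametrisations; compactness gives a minimizer
(\<open>lipschitz_joined_limit\<close>), and rectifiable curves can be so parametrised
(\<open>rectifiable_imp_lipschitz_joined\<close>).\<close>

section \<open>Jordan curves in the plane\<close>

text \<open>This carries the Jordan curve theorem from the complex plane to \<open>real^2\<close>. Being inside a set is a
matter of connectedness and boundedness, and linear maps preserve both.\<close>

lemma inside_linear_image:
  fixes f :: "'a::euclidean_space \<Rightarrow> 'b::euclidean_space" and g :: "'b \<Rightarrow> 'a"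
  assumes "linear f" "linear g" "\<And>x. g (f x) = x" "\<And>y. f (g y) = y"
  shows "inside (f ` S) = f ` inside S"
proof -
  have *: "f' ` inside T \<subseteq> inside (f' ` T)"
    if "linear f'" "linear g'" "\<And>x. g' (f' x) = x" "\<And>y. f' (g' y) = y"
    for f' :: "'c::euclidean_space \<Rightarrow> 'd::euclidean_space" and g' T
  proof
    fix y assume "y \<in> f' ` inside T"
    then obtain x where x: "x \<in> inside T" "y = f' x" by blast
    define C where "C = connected_component_set (- f' ` T) y"
    have yn: "y \<notin> f' ` T"
      using x that(3) by (metis imageE inside_no_overlap disjoint_iff)
    have "connected (g' ` C)"
      unfolding C_def
      by (intro connected_continuous_image linear_continuous_on linear_conv_bounded_linear[THEN iffD1] that(2)) simp
    moreover have "x \<in> g' ` C"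
      using yn x that(3) by (metis C_def ComplI connected_component_refl imageI mem_Collect_eq)
    moreover have "g' ` C \<subseteq> - T"
    proof safe
      fix z assume "z \<in> C" "g' z \<in> T"
      then have "z \<in> f' ` T" by (metis that(4) imageI)
      then show False
        using \<open>z \<in> C\<close> connected_component_subset[of "- f' ` T" y] unfolding C_def by blast
    qed
    ultimately have "g' ` C \<subseteq> connected_component_set (- T) x"
      by (intro connected_component_maximal)
    then have "bounded (g' ` C)"
      using x(1) bounded_subset unfolding inside_def by blast
    then have "bounded (f' ` g' ` C)"
      using bounded_linear_image[of "g' ` C" f'] that(1) linear_conv_bounded_linear by blast
    moreover have "f' ` g' ` C = C" by (simp add: image_image that(4))
    ultimately show "y \<in> inside (f' ` T)"
      using yn unfolding C_def inside_def by simp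
  qed
  have "g ` inside (f ` S) \<subseteq> inside (g ` f ` S)"
    by (rule *) (use assms in auto)
  also have "g ` f ` S = S" by (simp add: image_image assms(3))
  finally have "f ` g ` inside (f ` S) \<subseteq> f ` inside S" by blast
  then have "inside (f ` S) \<subseteq> f ` inside S" by (simp add: image_image assms(4))
  with *[OF assms] show ?thesis by blast
qed

lemma Jordan_inside_frontier:
  fixes c :: "real \<Rightarrow> real^2"
  assumes "simple_path c" "pathfinish c = pathstart c"
  shows "inside (path_image c) \<noteq> {}" "frontier (inside (path_image c)) = path_image c"
proof -
  have "DIM(real^2) = DIM(complex)" by simp
  then obtain f :: "real^2 \<Rightarrow> complex" and g where fg: "linear f" "linear g"
    "\<And>x. g (f x) = x" "\<And>y. f (g y) = y"
    using isomorphisms_UNIV_UNIV by metis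
  have inj: "inj f" by (metis fg(3) injI)
  have "surj f" by (metis fg(4) surjI)
  then have "interior (f ` S) = f ` interior S" for S
    using fg inj by (simp add: interior_surjective_linear_image interior_bijective_linear_image bij_def)
  have im: "path_image (f \<circ> c) = f ` path_image c" by (simp add: path_image_compose)
  have "simple_path (f \<circ> c)" "pathfinish (f \<circ> c) = pathstart (f \<circ> c)"
    using assms fg inj by (auto simp: simple_path_linear_image_eq pathfinish_def pathstart_def)
  from Jordan_inside_outside[OF this]
  have 1: "f ` inside (path_image c) \<noteq> {}"
    and 2: "frontier (f ` inside (path_image c)) = f ` path_image c"
    by (simp_all add: im inside_linear_image[OF fg])
  show "inside (path_image c) \<noteq> {}" using 1 by blast
  have "frontier (f ` inside (path_image c)) = f ` frontier (inside (path_image c))"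
    unfolding frontier_def using fg inj \<open>\<And>S. interior (f ` S) = f ` interior S\<close>
    by (simp add: closure_injective_linear_image image_set_diff)
  with 2 show "frontier (inside (path_image c)) = path_image c"
    using inj by (metis inj_image_eq_iff)
qed

section \<open>Taut arcs\<close>

text \<open>A set is straight in \<open>J\<close> if it contains, with two points, their segment as soon as that segment lies
in \<open>J\<close>. Tautness of an arc asks a bit more: the segment is covered by the part of the arc between
the two parameters, so that it visibly passes to subarcs. The geodesics of the length metric are taut, and tautness is all that the planar argument
uses about them.\<close>

definition straight_in :: "(real^2) set \<Rightarrow> (real^2) set \<Rightarrow> bool" where
  "straight_in J G \<longleftrightarrow>
     (\<forall>x\<in>G. \<forall>y\<in>G. closed_segment x y \<subseteq> J \<longrightarrow> closed_segment x y \<subseteq> G)"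

definition taut :: "(real^2) set \<Rightarrow> (real \<Rightarrow> real^2) \<Rightarrow> bool" where
  "taut J g \<longleftrightarrow> arc g \<and> path_image g \<subseteq> J \<and>
     (\<forall>s\<in>{0..1}. \<forall>t\<in>{0..1}. closed_segment (g s) (g t) \<subseteq> J \<longrightarrow>
        closed_segment (g s) (g t) \<subseteq> g ` closed_segment s t)"

lemma straight_in_taut: "taut J g \<Longrightarrow> straight_in J (path_image g)"
proof (unfold straight_in_def, intro ballI impI)
  fix x y assume g: "taut J g" "x \<in> path_image g" "y \<in> path_image g" "closed_segment x y \<subseteq> J"
  then obtain s t where st: "s \<in> {0..1}" "t \<in> {0..1}" "x = g s" "y = g t"
    by (auto simp: path_image_def)
  then have "closed_segment x y \<subseteq> g ` closed_segment s t"
    using g unfolding taut_def by blast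
  also have "\<dots> \<subseteq> path_image g"
    using st unfolding path_image_def by (intro image_mono closed_segment_subset) auto
  finally show "closed_segment x y \<subseteq> path_image g" .
qed

lemma taut_subpath:
  assumes g: "taut J g" and uv: "u \<in> {0..1}" "v \<in> {0..1}" "u \<noteq> v"
  shows "taut J (subpath u v g)"
proof -
  have aff: "(\<lambda>x. (v - u) * x + u) ` closed_segment s t
      = closed_segment ((v - u) * s + u) ((v - u) * t + u)" for s t :: real
  proof -
    have "(\<lambda>x. (v - u) * x + u) ` closed_segment s t = (+) u ` (\<lambda>x. (v - u) * x) ` closed_segment s t"
      by (auto simp: image_image add.commute)
    also have "(\<lambda>x. (v - u) * x) ` closed_segment s t = closed_segment ((v - u) * s) ((v - u) * t)"
      by (rule closed_segment_linear_image[symmetric]) (simp add: linear_times)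
    also have "(+) u ` \<dots> = closed_segment ((v - u) * s + u) ((v - u) * t + u)"
      by (metis closed_segment_translation add.commute)
    finally show ?thesis .
  qed
  have in01: "(v - u) * s + u \<in> {0..1}" if "s \<in> {0..1}" for s
  proof -
    have "(v - u) * s + u \<in> closed_segment u v"
      using that by (auto simp: closed_segment_def algebra_simps intro!: exI[of _ s])
    also have "\<dots> \<subseteq> {0..1}" using uv by (intro closed_segment_subset) auto
    finally show ?thesis .
  qed
  show ?thesis
    unfolding taut_def
  proof (intro conjI ballI impI)
    show "arc (subpath u v g)" using g uv by (simp add: taut_def arc_subpath_arc)
    show "path_image (subpath u v g) \<subseteq> J"
      using g uv path_image_subpath_subset[of u v g] unfolding taut_def by blast
  next
    fix s t :: real assume st: "s \<in> {0..1}" "t \<in> {0..1}"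
      and "closed_segment (subpath u v g s) (subpath u v g t) \<subseteq> J"
    then have "closed_segment (subpath u v g s) (subpath u v g t)
       \<subseteq> g ` closed_segment ((v - u) * s + u) ((v - u) * t + u)"
      using g in01[of s] in01[of t] unfolding taut_def subpath_def by blast
    then show "closed_segment (subpath u v g s) (subpath u v g t) \<subseteq> subpath u v g ` closed_segment s t"
      by (simp add: aff[symmetric] image_image subpath_def)
  qed
qed

lemma taut_reversepath: "taut J g \<Longrightarrow> taut J (reversepath g)"
proof -
  assume "taut J g"
  then have "taut J (subpath 1 0 g)" by (rule taut_subpath) auto
  moreover have "subpath 1 0 g = reversepath g" by (auto simp: subpath_def reversepath_def)
  ultimately show ?thesis by simp
qed

lemma straight_in_convex: "convex G \<Longrightarrow> straight_in J G"
  unfolding straight_in_def convex_contains_segment by blast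

section \<open>Regions enclosed by taut arcs\<close>

lemma maximal_gap:
  fixes g :: "real \<Rightarrow> 'a::topological_space"
  assumes g: "continuous_on {0..1} g" and K: "closed K"
    and ends: "g 0 \<in> K" "g 1 \<in> K" and t: "t \<in> {0..1}" "g t \<notin> K"
  obtains a b where "0 \<le> a" "a < t" "t < b" "b \<le> 1" "g a \<in> K" "g b \<in> K"
    "\<And>u. a < u \<Longrightarrow> u < b \<Longrightarrow> g u \<notin> K"
proof -
  define Z where "Z = {0..1} \<inter> g -` K"
  have "closed Z" unfolding Z_def using g K by (intro continuous_closed_preimage) auto
  have Z1: "compact (Z \<inter> {0..t})" "compact (Z \<inter> {t..1})"
    using \<open>closed Z\<close> by (auto intro: closed_Int_compact)
  have "0 \<in> Z \<inter> {0..t}" "1 \<in> Z \<inter> {t..1}" using ends t unfolding Z_def by auto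
  then have "Z \<inter> {0..t} \<noteq> {}" "Z \<inter> {t..1} \<noteq> {}" by blast+
  then obtain a b where a: "a \<in> Z \<inter> {0..t}" "\<And>u. u \<in> Z \<inter> {0..t} \<Longrightarrow> u \<le> a"
    and b: "b \<in> Z \<inter> {t..1}" "\<And>u. u \<in> Z \<inter> {t..1} \<Longrightarrow> b \<le> u"
    using compact_attains_sup[OF Z1(1)] compact_attains_inf[OF Z1(2)] by blast
  have "a \<noteq> t" "b \<noteq> t" using a(1) b(1) t unfolding Z_def by auto
  show ?thesis
  proof (rule that[of a b])
    fix u assume u: "a < u" "u < b"
    show "g u \<notin> K"
    proof
      assume "g u \<in> K"
      then have "u \<in> Z" using u a(1) b(1) unfolding Z_def by auto
      then show False using a b u by (cases "u \<le> t") force+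
    qed
  qed (use a(1) b(1) \<open>a \<noteq> t\<close> \<open>b \<noteq> t\<close> in \<open>auto simp: Z_def\<close>)
qed

lemma mem_segment_of_opposite_rays:
  fixes u v :: "'a::real_vector"
  assumes "s > 0" "t > 0"
  shows "u \<in> closed_segment (u - t *\<^sub>R v) (u + s *\<^sub>R v)"
proof -
  have "(1 - t / (s + t)) *\<^sub>R (u - t *\<^sub>R v) + (t / (s + t)) *\<^sub>R (u + s *\<^sub>R v)
     = u + (t * s / (s + t) - (1 - t / (s + t)) * t) *\<^sub>R v"
    by (simp add: algebra_simps)
  also have "t * s / (s + t) - (1 - t / (s + t)) * t = 0"
    using assms by (simp add: field_simps)
  finally show ?thesis
    unfolding in_segment using assms by (intro exI[of _ "t / (s + t)"]) auto
qed

text \<open>A connected complement says that \<open>J\<close> has no holes: whatever a subset of \<open>J\<close> encloses is again in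
\<open>J\<close>. This is what makes chords of an enclosed region admissible shortcuts.\<close>

locale planar_domain =
  fixes J :: "(real^2) set"
  assumes compact_J: "compact J" and connected_outer: "connected (- J)"
begin

lemma inside_subset_domain:
  assumes "S \<subseteq> J"
  shows "inside S \<subseteq> J"
  using inside_mono[OF assms] inside_bounded_complement_connected_empty[OF connected_outer]
    compact_imp_bounded[OF compact_J] by blast

lemma ray_meets:
  assumes S: "compact S" "S \<subseteq> J" and u: "u \<in> inside S" and v: "v \<noteq> 0"
  obtains s where "s > 0" "u + s *\<^sub>R v \<in> S" "closed_segment u (u + s *\<^sub>R v) \<subseteq> J"
proof -
  have op: "open (inside S)" using S by (simp add: open_inside compact_imp_closed)
  have bd: "bounded (inside S)" using S by (simp add: bounded_inside compact_imp_bounded)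
  obtain s where s: "0 < s" "u + s *\<^sub>R v \<in> frontier (inside S)"
    "\<And>e. \<lbrakk>0 \<le> e; e < s\<rbrakk> \<Longrightarrow> u + e *\<^sub>R v \<in> interior (inside S)"
    using ray_to_frontier[OF bd _ v, of u] u op by (auto simp: interior_open)
  have inS: "u + s *\<^sub>R v \<in> S"
    using s(2) frontier_inside_subset[of S] S by (auto simp: compact_imp_closed)
  have "closed_segment u (u + s *\<^sub>R v) \<subseteq> J"
  proof
    fix x assume "x \<in> closed_segment u (u + s *\<^sub>R v)"
    then obtain t where t: "0 \<le> t" "t \<le> 1" "x = u + (t * s) *\<^sub>R v"
      by (auto simp: closed_segment_def algebra_simps)
    show "x \<in> J"
    proof (cases "t = 1")
      case True then show ?thesis using inS S t by auto
    next
      case False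
      then have "t * s < s" using t s(1) by simp
      then have "x \<in> interior (inside S)" using s(1) t by (auto intro!: s(3))
      then show ?thesis using inside_subset_domain[OF S(2)] interior_subset by blast
    qed
  qed
  then show ?thesis using that s(1) inS by blast
qed

text \<open>Extend a point enclosed by \<open>S\<close> to a chord of the enclosed region. If both ends were on the same
straight piece of \<open>S\<close>, the piece would contain the chord, hence the enclosed point.\<close>

lemma chord_separates:
  assumes S: "compact S" "S \<subseteq> J" and u: "u \<in> inside S"
    and G: "G \<subseteq> S" "straight_in J G" and st: "s > 0" "t > 0"
    and "u + s *\<^sub>R v \<in> G" "u - t *\<^sub>R v \<in> G"
    and "closed_segment u (u + s *\<^sub>R v) \<subseteq> J" "closed_segment u (u - t *\<^sub>R v) \<subseteq> J"
  shows False
proof -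
  have inseg: "u \<in> closed_segment (u - t *\<^sub>R v) (u + s *\<^sub>R v)"
    using st by (rule mem_segment_of_opposite_rays)
  then have "closed_segment (u - t *\<^sub>R v) (u + s *\<^sub>R v) \<subseteq> J"
    using Un_closed_segment[of u "u - t *\<^sub>R v" "u + s *\<^sub>R v"] assms(10,11) 
    by (metis Un_subset_iff closed_segment_commute)
  then have "u \<in> G"
    using inseg assms(8,9) G(2) unfolding straight_in_def by blast
  then show False using u G(1) inside_no_overlap[of S] by blast
qed

text \<open>Concavity of taut curves, in the form of a statement about corners. Suppose that near the extreme
point \<open>e\<close> there is only one piece \<open>G\<close>. Cut off a small cap around \<open>e\<close> by a line and take an enclosed
point in the cap. Its chord parallel to the line stays in the cap, so it has both ends in \<open>G\<close>, which
is impossible.\<close>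

lemma extreme_point_in_two:
  assumes S: "compact S" "S \<subseteq> J" and e: "e extreme_point_of (convex hull S)"
    and lim: "e \<in> closure (inside S)"
    and F: "finite F" "S = \<Union>F" "\<And>G. G \<in> F \<Longrightarrow> closed G" "\<And>G. G \<in> F \<Longrightarrow> straight_in J G"
  shows "\<exists>G\<in>F. \<exists>H\<in>F. G \<noteq> H \<and> e \<in> G \<and> e \<in> H"
proof (rule ccontr)
  assume neg: "\<not> ?thesis"
  have "e \<in> S" using e by (rule extreme_point_of_convex_hull)
  then obtain G where G: "G \<in> F" "e \<in> G" using F(2) by blast
  define R where "R = \<Union>(F - {G})"
  have "closed R" unfolding R_def using F by auto
  moreover have "e \<notin> R" using neg G unfolding R_def by blast
  ultimately obtain \<epsilon> where eps: "\<epsilon> > 0" "ball e \<epsilon> \<inter> R = {}"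
    by (metis open_Compl ComplI openE disjoint_eq_subset_Compl)
  \<comment> \<open>The cap is the side of \<open>e\<close> of a line that separates \<open>e\<close> from all points of \<open>S\<close> outside a small ball.\<close>
  define K where "K = S - ball e \<epsilon>"
  have cK: "compact K" unfolding K_def using S by (simp add: compact_diff)
  have "e \<notin> convex hull K"
  proof
    assume "e \<in> convex hull K"
    moreover have "convex hull K \<subseteq> convex hull S" unfolding K_def by (rule hull_mono) auto
    ultimately have "e extreme_point_of (convex hull K)"
      using e unfolding extreme_point_of_def by blast
    then have "e \<in> K" by (rule extreme_point_of_convex_hull)
    then show False using eps(1) unfolding K_def by simp
  qed
  then obtain n \<beta> where n: "inner n e < \<beta>" "\<And>x. x \<in> convex hull K \<Longrightarrow> inner n x > \<beta>"
    using separating_hyperplane_closed_point[of "convex hull K" e] cK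
    by (metis compact_convex_hull compact_imp_closed convex_convex_hull)
  have cap: "x \<in> G" if "x \<in> S" "inner n x < \<beta>" for x
  proof -
    have "x \<in> ball e \<epsilon>"
      using that n(2)[of x] hull_inc[of x K convex] unfolding K_def by (metis Diff_iff not_less_iff_gr_or_eq)
    then show ?thesis using that(1) eps(2) F(2) unfolding R_def by blast
  qed
  have "open {x. inner n x < \<beta>}" by (rule open_halfspace_lt)
  then obtain u where u: "u \<in> inside S" "inner n u < \<beta>"
    using lim n(1) open_Int_closure_eq_empty[of "{x. inner n x < \<beta>}" "inside S"] by blast
  obtain v :: "real^2" where v: "v \<noteq> 0" "inner n v = 0"
    using orthogonal_to_vector_exists[of n] by (auto simp: orthogonal_def)
  obtain s where s: "s > 0" "u + s *\<^sub>R v \<in> S" "closed_segment u (u + s *\<^sub>R v) \<subseteq> J"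
    using ray_meets[OF S u(1) v(1)] .
  obtain t where t: "t > 0" "u - t *\<^sub>R v \<in> S" "closed_segment u (u - t *\<^sub>R v) \<subseteq> J"
    using ray_meets[OF S u(1), of "- v"] v(1) by auto
  have "u + s *\<^sub>R v \<in> G" "u - t *\<^sub>R v \<in> G"
    using s t u v by (auto intro!: cap simp: inner_simps)
  then show False
    using chord_separates[OF S u(1) _ _ s(1) t(1), of G] s t F G by blast
qed

text \<open>The extreme points of the hull lie on the curve, and each point of a Jordan curve is a limit of
points inside it. So only the corners, where two pieces meet, can be extreme.\<close>

lemma Jordan_curve_in_hull_of_corners:
  assumes c: "simple_path c" "pathfinish c = pathstart c" "path_image c \<subseteq> J"
    and F: "finite F" "path_image c = \<Union>F" "\<And>G. G \<in> F \<Longrightarrow> closed G" "\<And>G. G \<in> F \<Longrightarrow> straight_in J G"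
    and V: "\<And>G H. \<lbrakk>G \<in> F; H \<in> F; G \<noteq> H\<rbrakk> \<Longrightarrow> G \<inter> H \<subseteq> V"
  shows "path_image c \<union> inside (path_image c) \<subseteq> convex hull V"
proof -
  let ?S = "path_image c"
  have cS: "compact ?S" using c(1) by (simp add: compact_simple_path_image)
  have "{e. e extreme_point_of (convex hull ?S)} \<subseteq> V"
  proof safe
    fix e assume e: "e extreme_point_of (convex hull ?S)"
    then have "e \<in> frontier (inside ?S)"
      using Jordan_inside_frontier(2)[OF c(1,2)] extreme_point_of_convex_hull by blast
    then have "e \<in> closure (inside ?S)" unfolding frontier_def by blast
    from extreme_point_in_two[OF cS c(3) e this F] show "e \<in> V" using V by blast
  qed
  then have "convex hull ?S \<subseteq> convex hull V"
    using Krein_Milman_Minkowski[of "convex hull ?S"] cS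
    by (metis compact_convex_hull convex_convex_hull hull_mono)
  moreover have "inside ?S \<subseteq> convex hull ?S"
    using inside_mono[of ?S "convex hull ?S"] inside_convex[of "convex hull ?S"]
    by (auto simp: hull_subset)
  ultimately show ?thesis using hull_subset[of ?S convex] by blast
qed

text \<open>A bigon has only two corners. Its inside would be an open set contained in a segment.\<close>

lemma no_taut_bigon:
  assumes g: "taut J g" and h: "taut J h"
    and ends: "pathstart h = pathstart g" "pathfinish h = pathfinish g"
    and int: "path_image g \<inter> path_image h \<subseteq> {pathstart g, pathfinish g}"
  shows False
proof -
  let ?c = "g +++ reversepath h"
  have arcs: "arc g" "arc h" using g h by (auto simp: taut_def)
  have c: "simple_path ?c" "pathfinish ?c = pathstart ?c"
    using arcs ends int by (auto intro!: simple_path_join_loop simp: arc_reversepath)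
  have im: "path_image ?c = path_image g \<union> path_image h"
    using ends by (simp add: path_image_join)
  have "path_image ?c \<union> inside (path_image ?c) \<subseteq> convex hull {pathstart g, pathfinish g}"
  proof (rule Jordan_curve_in_hull_of_corners[where F = "{path_image g, path_image h}"])
    show "path_image ?c \<subseteq> J" using g h im by (auto simp: taut_def)
  qed (use c im g h int arcs in \<open>auto simp: straight_in_taut closed_arc_image\<close>)
  then have "inside (path_image ?c) \<subseteq> interior (closed_segment (pathstart g) (pathfinish g))"
    using c by (intro interior_maximal) (auto simp: segment_convex_hull closed_simple_path_image open_inside)
  then show False
    using Jordan_inside_frontier(1)[OF c] by (simp add: interior_closed_segment_ge2)
qed

text \<open>Uniqueness of geodesics: a stretch of \<open>g\<close> outside the image of \<open>h\<close> would form a bigon with \<open>h\<close>.\<close>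

lemma taut_path_within:
  assumes g: "taut J g" and h: "taut J h"
    and ends: "pathstart g \<in> path_image h" "pathfinish g \<in> path_image h"
  shows "path_image g \<subseteq> path_image h"
proof (rule ccontr)
  assume "\<not> ?thesis"
  then obtain t where t: "t \<in> {0..1}" "g t \<notin> path_image h" unfolding path_image_def by blast
  have arcs: "arc g" "arc h" using g h by (auto simp: taut_def)
  obtain a b where ab: "0 \<le> a" "a < t" "t < b" "b \<le> 1" "g a \<in> path_image h" "g b \<in> path_image h"
    "\<And>u. a < u \<Longrightarrow> u < b \<Longrightarrow> g u \<notin> path_image h"
    using maximal_gap[of g "path_image h" t] t ends arcs
    by (auto simp: pathstart_def pathfinish_def closed_arc_image arc_def path_def)
  obtain \<sigma> \<tau> where st: "\<sigma> \<in> {0..1}" "\<tau> \<in> {0..1}" "g a = h \<sigma>" "g b = h \<tau>"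
    using ab(5,6) unfolding path_image_def by blast
  have "g a \<noteq> g b" using arcs(1) ab(1-4) unfolding arc_def inj_on_def by force
  then have "\<sigma> \<noteq> \<tau>" using st by auto
  show False
  proof (rule no_taut_bigon[of "subpath a b g" "subpath \<sigma> \<tau> h"])
    have "path_image (subpath \<sigma> \<tau> h) \<subseteq> path_image h"
      using st by (intro path_image_subpath_subset) auto
    moreover have "path_image (subpath a b g) = g ` {a..b}" using ab by (simp add: path_image_subpath)
    ultimately show "path_image (subpath a b g) \<inter> path_image (subpath \<sigma> \<tau> h)
        \<subseteq> {pathstart (subpath a b g), pathfinish (subpath a b g)}"
      using ab(7) by (force simp: le_less)
  qed (use g h ab st \<open>\<sigma> \<noteq> \<tau>\<close> in \<open>auto intro!: taut_subpath\<close>)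
qed

lemma closed_segment_subset_iff:
  "closed_segment x y \<subseteq> J \<longleftrightarrow> (\<forall>s\<in>{0..1}. (1 - s) *\<^sub>R x + s *\<^sub>R y \<in> J)"
  by (auto simp: closed_segment_image_interval)

text \<open>Rotate a chord through \<open>u\<close>. Let \<open>P\<close> be the set of directions in which \<open>\<alpha>\<close> can be reached by a segment
in \<open>J\<close>; it is closed, and opposite directions are not both in \<open>P\<close>. As the circle is connected, it is
not the union of \<open>P\<close> and \<open>- P\<close>. A chord in one of the remaining directions avoids \<open>\<alpha>\<close> at both ends,
and its ends are on different sides.\<close>

lemma chord_between_other_sides:
  assumes S: "compact S" "S \<subseteq> J" "S = \<alpha> \<union> \<beta> \<union> \<gamma>"
    and cl: "closed \<alpha>" and straight: "straight_in J \<alpha>" "straight_in J \<beta>" "straight_in J \<gamma>"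
    and u: "u \<in> inside S"
  obtains B C where "B \<in> \<gamma>" "C \<in> \<beta>" "u \<in> closed_segment B C" "closed_segment B C \<subseteq> J"
proof -
  have uS: "u \<notin> S" using u inside_no_overlap by blast
  define W where "W = {x \<in> \<alpha>. closed_segment u x \<subseteq> J}"
  define P where "P = (\<lambda>x. sgn (x - u)) ` W"
  have "W = S \<inter> \<alpha> \<inter> (\<Inter>s\<in>{0..1}. (\<lambda>x. (1 - s) *\<^sub>R u + s *\<^sub>R x) -` J)"
    unfolding W_def closed_segment_subset_iff using S(3) by auto
  moreover have "closed (\<alpha> \<inter> (\<Inter>s\<in>{0..1}. (\<lambda>x. (1 - s) *\<^sub>R u + s *\<^sub>R x) -` J))"
    using cl compact_imp_closed[OF compact_J]
    by (intro closed_Int closed_INT ballI closed_vimage continuous_intros)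
  ultimately have "compact W" using compact_Int_closed[OF S(1)] by (simp only: Int_assoc)
  then have "compact P"
    unfolding P_def using uS S(3)
    by (intro compact_continuous_image continuous_intros) (auto simp: W_def)
  then have cP: "closed P" "closed (uminus ` P)"
    by (auto intro: compact_imp_closed compact_negations)
  have expand: "u + norm (x - u) *\<^sub>R sgn (x - u) = x" for x
    by (cases "x = u") (simp_all add: sgn_div_norm)
  have disj: "P \<inter> uminus ` P = {}"
  proof (rule equals0I)
    fix v assume "v \<in> P \<inter> uminus ` P"
    then have "v \<in> P" "- v \<in> P" by auto
    then obtain x y where xy: "x \<in> W" "y \<in> W" "v = sgn (x - u)" "- v = sgn (y - u)"
      unfolding P_def by blast
    have "x \<noteq> u" "y \<noteq> u" using xy(1,2) uS S(3) unfolding W_def by auto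
    moreover have "u + norm (x - u) *\<^sub>R v = x" "u - norm (y - u) *\<^sub>R v = y"
      using expand[of x] expand[of y] by (simp_all flip: xy(3,4))
    ultimately show False
      using chord_separates[OF S(1,2) u, of \<alpha> "norm (x - u)" "norm (y - u)" v] S(3) straight xy(1,2)
      unfolding W_def by auto
  qed
  have "\<not> sphere (0::real^2) 1 \<subseteq> P \<union> uminus ` P"
  proof
    assume sub: "sphere (0::real^2) 1 \<subseteq> P \<union> uminus ` P"
    obtain v :: "real^2" where v: "v \<in> sphere 0 1"
      using vector_choose_size[of 1] by auto
    then have "v \<in> P \<and> - v \<in> uminus ` P \<or> - v \<in> P \<and> v \<in> uminus ` P" using sub by force
    then have "P \<inter> sphere 0 1 \<noteq> {}" "uminus ` P \<inter> sphere 0 1 \<noteq> {}"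
      using v by (metis disjoint_iff dist_0_norm mem_sphere norm_minus_cancel)+
    moreover have "connected (sphere (0::real^2) 1)" by (simp add: connected_sphere)
    ultimately show False
      using cP disj sub unfolding connected_closed by blast
  qed
  then obtain v where v: "norm v = 1" "v \<notin> P" "v \<notin> uminus ` P"
    unfolding subset_iff mem_sphere_0 by blast
  then have "v \<noteq> 0" by auto
  obtain s where s: "s > 0" "u + s *\<^sub>R v \<in> S" "closed_segment u (u + s *\<^sub>R v) \<subseteq> J"
    using ray_meets[OF S(1,2) u \<open>v \<noteq> 0\<close>] .
  obtain t where t: "t > 0" "u - t *\<^sub>R v \<in> S" "closed_segment u (u - t *\<^sub>R v) \<subseteq> J"
    using ray_meets[OF S(1,2) u, of "- v"] \<open>v \<noteq> 0\<close> by auto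
  have sgn: "sgn (s *\<^sub>R v) = v" "sgn (- (t *\<^sub>R v)) = - v"
    using s(1) t(1) v(1) by (auto simp: sgn_scaleR sgn_div_norm)
  have "u + s *\<^sub>R v \<notin> \<alpha>"
  proof
    assume "u + s *\<^sub>R v \<in> \<alpha>"
    then have "sgn (u + s *\<^sub>R v - u) \<in> P" unfolding P_def W_def using s(3) by blast
    then show False using sgn v(2) by simp
  qed
  moreover have "u - t *\<^sub>R v \<notin> \<alpha>"
  proof
    assume "u - t *\<^sub>R v \<in> \<alpha>"
    then have "sgn (u - t *\<^sub>R v - u) \<in> P" unfolding P_def W_def using t(3) by blast
    then show False using sgn v(3) by (simp add: image_iff) (metis minus_minus)
  qed
  moreover have "\<not> (u + s *\<^sub>R v \<in> G \<and> u - t *\<^sub>R v \<in> G)" if "G = \<beta> \<or> G = \<gamma>" for G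
    using chord_separates[OF S(1,2) u, of G s t v] s t S(3) straight that by blast
  ultimately have alt: "u + s *\<^sub>R v \<in> \<gamma> \<and> u - t *\<^sub>R v \<in> \<beta> \<or> u - t *\<^sub>R v \<in> \<gamma> \<and> u + s *\<^sub>R v \<in> \<beta>"
    using s(2) t(2) S(3) by blast
  have inseg: "u \<in> closed_segment (u - t *\<^sub>R v) (u + s *\<^sub>R v)"
    using s(1) t(1) by (rule mem_segment_of_opposite_rays)
  then have "closed_segment (u - t *\<^sub>R v) (u + s *\<^sub>R v) \<subseteq> J"
    using Un_closed_segment[of u "u - t *\<^sub>R v" "u + s *\<^sub>R v"] s t
    by (metis Un_subset_iff closed_segment_commute)
  then show ?thesis using alt inseg that by (metis closed_segment_commute)
qed

text \<open>Chords between two compact sides form a compact family, so the points that they cover form a closed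
set.\<close>

lemma chord_through_limit_point:
  assumes S: "compact S" "S \<subseteq> J" "S = \<alpha> \<union> \<beta> \<union> \<gamma>"
    and cl: "closed \<alpha>" "closed \<beta>" "closed \<gamma>"
    and straight: "straight_in J \<alpha>" "straight_in J \<beta>" "straight_in J \<gamma>"
    and p: "p \<in> closure (inside S)"
  obtains B C where "B \<in> \<gamma>" "C \<in> \<beta>" "p \<in> closed_segment B C" "closed_segment B C \<subseteq> J"
proof -
  have cpt: "compact \<beta>" "compact \<gamma>"
    using S cl by (metis compact_Int_closed Int_absorb1 Un_upper1 Un_upper2 le_supI1)+
  define Q where "Q = (\<gamma> \<times> \<beta>) \<inter> (\<Inter>s\<in>{0..1}. (\<lambda>z. (1 - s) *\<^sub>R fst z + s *\<^sub>R snd z) -` J)"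
  have Q: "Q = {(B, C). B \<in> \<gamma> \<and> C \<in> \<beta> \<and> closed_segment B C \<subseteq> J}"
    unfolding Q_def closed_segment_subset_iff by auto
  have "compact Q"
    unfolding Q_def using cpt compact_imp_closed[OF compact_J]
    by (intro compact_Int_closed compact_Times closed_INT ballI closed_vimage continuous_intros)
  then have "compact ((\<lambda>(z, t). (1 - t) *\<^sub>R fst z + t *\<^sub>R snd z) ` (Q \<times> {0..1::real}))" (is "compact ?I")
    by (intro compact_continuous_image compact_Times) (auto simp: case_prod_unfold intro!: continuous_intros)
  then have "closed ?I" by (rule compact_imp_closed)
  moreover have "inside S \<subseteq> ?I"
  proof
    fix u assume "u \<in> inside S"
    then obtain B C where "B \<in> \<gamma>" "C \<in> \<beta>" "u \<in> closed_segment B C" "closed_segment B C \<subseteq> J"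
      using chord_between_other_sides[OF S cl(1) straight] by metis
    then show "u \<in> ?I" unfolding Q in_segment by force
  qed
  ultimately have "p \<in> ?I" using p closure_minimal by blast
  then obtain B C t where "(B, C) \<in> Q" "0 \<le> t" "t \<le> 1" "p = (1 - t) *\<^sub>R B + t *\<^sub>R C" by auto
  then show ?thesis using that[of B C] unfolding Q in_segment by blast
qed

end

section \<open>A distance bound in Euclidean triangles\<close>

text \<open>By convexity the distance from \<open>p\<close> to the side \<open>A B\<close> is at most \<open>s h\<^sub>1\<close> and the distance to \<open>A C\<close> at
most \<open>(1 - s) h\<^sub>2\<close>, where \<open>s\<close> is the position of \<open>p\<close> on \<open>B C\<close> and \<open>h\<^sub>1\<close>, \<open>h\<^sub>2\<close> are the lengths of
\<open>C q\<^sub>1\<close>, \<open>B q\<^sub>2\<close>. The smaller of the two bounds is largest when they agree, and then equals \<open>h\<^sub>1 h\<^sub>2 / (h\<^sub>1 + h\<^sub>2)\<close>.\<close>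

lemma triangle_cevian_bound:
  fixes A B C p :: "'a::real_inner"
  assumes p: "p \<in> closed_segment B C"
    and q: "q1 \<in> closed_segment A B" "q2 \<in> closed_segment A C"
    and h: "dist C q1 * dist B q2 \<le> r * (dist C q1 + dist B q2)" and r: "0 \<le> r"
  shows "\<exists>q \<in> closed_segment A B \<union> closed_segment A C. dist p q \<le> r"
proof (rule ccontr)
  assume neg: "\<not> ?thesis"
  let ?h1 = "dist C q1" and ?h2 = "dist B q2"
  obtain s where s: "0 \<le> s" "s \<le> 1" "p = (1 - s) *\<^sub>R B + s *\<^sub>R C"
    using p by (auto simp: in_segment)
  have "(1 - s) *\<^sub>R B + s *\<^sub>R q1 \<in> closed_segment A B"
    using s q(1) convexD[of "closed_segment A B" B q1 "1 - s" s] by auto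
  moreover have "dist p ((1 - s) *\<^sub>R B + s *\<^sub>R q1) = s * ?h1"
    using s by (simp add: dist_norm flip: scaleR_diff_right)
  ultimately have 1: "s * ?h1 > r" using neg by (metis UnI1 not_le)
  have "(1 - s) *\<^sub>R q2 + s *\<^sub>R C \<in> closed_segment A C"
    using s q(2) convexD[of "closed_segment A C" q2 C "1 - s" s] by auto
  moreover have "dist p ((1 - s) *\<^sub>R q2 + s *\<^sub>R C) = (1 - s) * ?h2"
    using s by (simp add: dist_norm flip: scaleR_diff_right)
  ultimately have 2: "(1 - s) * ?h2 > r" using neg by (metis UnI2 not_le)
  have pos: "?h1 > 0" "?h2 > 0"
    using 1 2 r s by (metis mult_zero_right not_le zero_le_dist order_le_less order.strict_trans1)+
  have "r * ?h2 < s * ?h1 * ?h2" "r * ?h1 < (1 - s) * ?h2 * ?h1"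
    using 1 2 pos by simp_all
  then have "r * (?h1 + ?h2) < ?h1 * ?h2" by (simp add: algebra_simps)
  then show False using h by simp
qed

text \<open>If the angle at \<open>B\<close> is not acute, \<open>B\<close> lies in the disk with diameter \<open>A C\<close>, so it has distance at most
\<open>D / 2\<close> from the midpoint of \<open>A C\<close>. The constant \<open>D / 3\<close> is the harmonic expression for \<open>D\<close> and
\<open>D / 2\<close>.\<close>

lemma triangle_bound_obtuse:
  fixes A B C p :: "'a::real_inner"
  assumes p: "p \<in> closed_segment B C"
    and D: "dist B C \<le> D" "dist A C \<le> D"
    and obtuse: "inner (A - B) (C - B) \<le> 0"
  shows "\<exists>q \<in> closed_segment A B \<union> closed_segment A C. dist p q \<le> D / 3"
proof (rule triangle_cevian_bound[where ?q1.0 = B and ?q2.0 = "midpoint A C"])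
  let ?M = "midpoint A C"
  have D0: "0 \<le> D" using D(1) zero_le_dist order.trans by blast
  have "(dist B ?M)\<^sup>2 = (norm ((1/2) *\<^sub>R ((A - B) + (C - B))))\<^sup>2"
  proof -
    have "(1/2) *\<^sub>R ((A - B) + (C - B)) = (1/2) *\<^sub>R (A + C) - (1/2) *\<^sub>R (B + B)"
      by (simp add: algebra_simps)
    also have "\<dots> = ?M - B"
      by (simp only: scaleR_half_double) (simp add: midpoint_def)
    finally have "?M - B = (1/2) *\<^sub>R ((A - B) + (C - B))" by simp
    then show ?thesis by (metis dist_norm dist_commute)
  qed
  also have "\<dots> = (norm (A - B + (C - B)))\<^sup>2 / 4" by (simp add: power2_eq_square)
  also have "(norm (A - B + (C - B)))\<^sup>2 \<le> (norm ((A - B) - (C - B)))\<^sup>2"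
    using obtuse by (simp add: power2_norm_eq_inner inner_add_left inner_add_right inner_diff_left inner_diff_right inner_commute)
  finally have "(dist B ?M)\<^sup>2 \<le> (dist A C)\<^sup>2 / 4" by (simp add: dist_norm)
  then have "(dist B ?M)\<^sup>2 \<le> (dist A C / 2)\<^sup>2" by (simp add: power_divide)
  then have "dist B ?M \<le> dist A C / 2" by (rule power2_le_imp_le) simp
  then have h2: "dist B ?M \<le> D / 2" using D(2) by simp
  have h1: "dist C B \<le> D" using D(1) by (simp add: dist_commute)
  have "dist C B * dist B ?M \<le> D * dist B ?M" "dist C B * dist B ?M \<le> dist C B * (D / 2)"
    using mult_right_mono[OF h1 zero_le_dist] mult_left_mono[OF h2 zero_le_dist] by blast+
  then show "dist C B * dist B ?M \<le> D / 3 * (dist C B + dist B ?M)"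
    by (simp add: algebra_simps)
  show "0 \<le> D / 3" using D0 by simp
qed (use p in \<open>auto simp: midpoint_in_closed_segment\<close>)

text \<open>In an acute triangle the two cevians are the altitudes, and the bound is twice the area divided by
\<open>b + c\<close>. Heron's formula estimates it, with equality for the equilateral triangle of side \<open>D\<close>
and the midpoint of a side. Obtuse triangles stay below this value.\<close>

lemma triangle_bound:
  fixes A B C p :: "'a::real_inner"
  assumes p: "p \<in> closed_segment B C"
    and D: "dist A B \<le> D" "dist A C \<le> D" "dist B C \<le> D"
  shows "\<exists>q \<in> closed_segment A B \<union> closed_segment A C. dist p q \<le> sqrt 3 / 4 * D"
proof -
  have D0: "0 \<le> D" using D(1) zero_le_dist order.trans by blast
  have s3: "4 / 3 \<le> sqrt 3" "sqrt 2 \<le> sqrt 3"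
    by (rule real_le_rsqrt) (simp_all add: power2_eq_square)
  have "D / 3 \<le> sqrt 3 / 4 * D" using s3(1) D0 mult_right_mono[of "1/3" "sqrt 3 / 4" D] by simp
  then have third: ?thesis if "\<exists>q \<in> closed_segment A B \<union> closed_segment A C. dist p q \<le> D / 3"
    using that order.trans by blast
  define u v where "u = B - A" and "v = C - A"
  define a b c m where "a = dist B C" and "b = norm v" and "c = norm u" and "m = inner u v"
  have abc: "a\<^sup>2 = b\<^sup>2 + c\<^sup>2 - 2 * m" "0 \<le> a" "0 \<le> b" "0 \<le> c" "a \<le> D" "b \<le> D" "c \<le> D"
  proof -
    have "a = norm (u - v)" unfolding a_def u_def v_def dist_norm by simp
    then show "a\<^sup>2 = b\<^sup>2 + c\<^sup>2 - 2 * m"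
      by (simp add: b_def c_def m_def power2_norm_eq_inner inner_diff_left inner_diff_right inner_commute)
    show "b \<le> D" "c \<le> D" using D unfolding b_def c_def u_def v_def by (simp_all add: dist_norm norm_minus_commute)
  qed (use D in \<open>auto simp: a_def b_def c_def\<close>)
  have bc: "dist C A = b" "dist B A = c" unfolding b_def c_def u_def v_def by (simp_all add: dist_norm)
  consider "m \<le> 0" | "inner (A - B) (C - B) \<le> 0" | "inner (A - C) (B - C) \<le> 0"
    | "0 < m" "0 < inner (A - B) (C - B)" "0 < inner (A - C) (B - C)" by linarith
  then show ?thesis
  proof cases
    case 1
    show ?thesis
    proof (rule triangle_cevian_bound[where ?q1.0 = A and ?q2.0 = A])
      have "b\<^sup>2 + c\<^sup>2 \<le> a\<^sup>2" using 1 abc(1) by simp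
      also have "a\<^sup>2 \<le> D\<^sup>2" using power_mono[of a D 2] abc(2,5) by blast
      finally have "(b + c)\<^sup>2 \<le> 2 * D\<^sup>2"
        using sum_squares_bound[of b c] by (simp add: power2_sum)
      then have "b + c \<le> sqrt (2 * D\<^sup>2)" by (rule real_le_rsqrt)
      also have "\<dots> = sqrt 2 * D" using D0 by (simp add: real_sqrt_mult)
      also have "\<dots> \<le> sqrt 3 * D" using s3(2) D0 by (simp add: mult_right_mono)
      finally have *: "(b + c) * (b + c) \<le> sqrt 3 * D * (b + c)" using abc by (intro mult_right_mono) auto
      have "4 * (b * c) \<le> (b + c) * (b + c)"
        using sum_squares_bound[of b c] by (simp add: power2_eq_square algebra_simps)
      then show "dist C A * dist B A \<le> sqrt 3 / 4 * D * (dist C A + dist B A)" using * bc by simp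
    qed (use p D0 in auto)
  next
    case 2 then show ?thesis using triangle_bound_obtuse[OF p D(3,2)] third by blast
  next
    case 3 
    then show ?thesis
      using triangle_bound_obtuse[of p C B D A] p D third by (metis Un_commute closed_segment_commute dist_commute)
  next
    case 4
    have mb: "m < b\<^sup>2" and mc: "m < c\<^sup>2"
    proof -
      have "inner (A - B) (C - B) = c\<^sup>2 - m" "inner (A - C) (B - C) = b\<^sup>2 - m"
        unfolding b_def c_def m_def u_def v_def
        by (simp_all add: power2_norm_eq_inner inner_diff_left inner_diff_right inner_commute)
      then show "m < b\<^sup>2" "m < c\<^sup>2" using 4 by simp_all
    qed
    have pos: "0 < b" "0 < c" "0 < D"
      using 4(1) mb mc abc by (auto simp: order_le_less)
    \<comment> \<open>\<open>K\<close> is twice the area of the triangle.\<close>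
    define K where "K = sqrt (b\<^sup>2 * c\<^sup>2 - m\<^sup>2)"
    have "m * m \<le> b\<^sup>2 * c\<^sup>2" using 4(1) mb mc by (intro mult_mono) auto
    then have K2: "K\<^sup>2 = b\<^sup>2 * c\<^sup>2 - m\<^sup>2" and K0: "0 \<le> K"
      unfolding K_def by (simp_all add: power2_eq_square)
    have foot: "norm (y - (m / (norm x)\<^sup>2) *\<^sub>R x) = K / norm x"
      if "norm x > 0" "m = inner x y" "(norm x)\<^sup>2 * (norm y)\<^sup>2 = b\<^sup>2 * c\<^sup>2" for x y :: 'a
    proof -
      have "(norm (y - k *\<^sub>R x))\<^sup>2 = (norm y)\<^sup>2 - 2 * k * inner x y + k\<^sup>2 * (norm x)\<^sup>2" for k
        unfolding power2_norm_eq_inner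
        by (simp add: inner_diff_left inner_diff_right inner_commute power2_eq_square algebra_simps)
      from this[of "m / (norm x)\<^sup>2"]
      have "(norm (y - (m / (norm x)\<^sup>2) *\<^sub>R x))\<^sup>2
          = (norm y)\<^sup>2 - 2 * (m / (norm x)\<^sup>2) * m + (m / (norm x)\<^sup>2)\<^sup>2 * (norm x)\<^sup>2"
        unfolding that(2)[symmetric] .
      also have "\<dots> = (norm y)\<^sup>2 - m\<^sup>2 / (norm x)\<^sup>2"
      proof -
        have *: "N - 2 * (m / X) * m + (m / X)\<^sup>2 * X = N - m\<^sup>2 / X" if "X > 0" for N X :: real
          using that by (simp add: power2_eq_square)
        show ?thesis using that(1) by (intro *) simp
      qed
      also have "\<dots> = (K / norm x)\<^sup>2"
        unfolding power_divide K2 that(3)[symmetric] using that(1) by (simp add: diff_divide_distrib)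
      finally show ?thesis by (rule power2_eq_imp_eq) (use K0 in auto)
    qed
    show ?thesis
    proof (rule triangle_cevian_bound[where ?q1.0 = "A + (m / c\<^sup>2) *\<^sub>R u" and ?q2.0 = "A + (m / b\<^sup>2) *\<^sub>R v"])
      have "A + t *\<^sub>R (X - A) \<in> closed_segment A X" if "0 \<le> t" "t \<le> 1" for t and X :: 'a
        using that by (auto simp: in_segment algebra_simps)
      moreover have "0 \<le> m / c\<^sup>2" "m / c\<^sup>2 \<le> 1" "0 \<le> m / b\<^sup>2" "m / b\<^sup>2 \<le> 1"
        using 4(1) mb mc pos by auto
      ultimately show "A + (m / c\<^sup>2) *\<^sub>R u \<in> closed_segment A B" "A + (m / b\<^sup>2) *\<^sub>R v \<in> closed_segment A C"
        unfolding u_def v_def by blast+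
      have h1: "dist C (A + (m / c\<^sup>2) *\<^sub>R u) = K / c"
        using foot[of u v] pos unfolding b_def c_def m_def
        by (simp add: dist_norm v_def mult.commute diff_diff_eq)
      have h2: "dist B (A + (m / b\<^sup>2) *\<^sub>R v) = K / b"
        using foot[of v u] pos unfolding b_def c_def m_def
        by (simp add: dist_norm u_def mult.commute diff_diff_eq inner_commute)
      let ?S = "(b + c)\<^sup>2"
      have a2: "a\<^sup>2 \<le> D\<^sup>2" using power_mono[of a D 2] abc(2,5) by blast
      have "b + c \<le> 2 * D" using abc by simp
      then have S4: "?S \<le> 4 * D\<^sup>2" using pos power_mono[of "b + c" "2 * D" 2] by (simp add: power_mult_distrib)
      \<comment> \<open>Discard the square of \<open>b - c\<close> in Heron's formula; use \<open>?S \<le> 4 D\<^sup>2\<close> and then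
        \<open>(D\<^sup>2 - a\<^sup>2) (3 D\<^sup>2 - a\<^sup>2) \<ge> 0\<close>.\<close>
      have heron: "4 * K\<^sup>2 = (?S - a\<^sup>2) * (a\<^sup>2 - (b - c)\<^sup>2)"
        unfolding K2 abc(1) by (simp add: power2_eq_square algebra_simps)
      have "a\<^sup>2 \<le> ?S" using abc(1) 4(1) mult_pos_pos[OF pos(1,2)] by (simp add: power2_sum)
      then have "4 * K\<^sup>2 \<le> (?S - a\<^sup>2) * a\<^sup>2"
        unfolding heron by (intro mult_left_mono) auto
      then have "4 * D\<^sup>2 * (4 * K\<^sup>2) \<le> 4 * D\<^sup>2 * ((?S - a\<^sup>2) * a\<^sup>2)"
        by (intro mult_left_mono) auto
      also have "\<dots> = 4 * D\<^sup>2 * ?S * a\<^sup>2 - 4 * D\<^sup>2 * (a\<^sup>2 * a\<^sup>2)" by (simp add: algebra_simps)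
      also have "\<dots> \<le> 4 * D\<^sup>2 * ?S * a\<^sup>2 - ?S * (a\<^sup>2 * a\<^sup>2)"
        using S4 mult_right_mono[OF S4, of "a\<^sup>2 * a\<^sup>2"] by simp
      also have "\<dots> = ?S * (3 * (D\<^sup>2 * D\<^sup>2) - (D\<^sup>2 - a\<^sup>2) * (3 * D\<^sup>2 - a\<^sup>2))" by (simp add: algebra_simps)
      also have "\<dots> \<le> ?S * (3 * (D\<^sup>2 * D\<^sup>2))"
      proof (rule mult_left_mono)
        have "a\<^sup>2 \<le> 3 * D\<^sup>2" using a2 zero_le_power2[of D] by linarith
        then show "3 * (D\<^sup>2 * D\<^sup>2) - (D\<^sup>2 - a\<^sup>2) * (3 * D\<^sup>2 - a\<^sup>2) \<le> 3 * (D\<^sup>2 * D\<^sup>2)"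
          using a2 mult_nonneg_nonneg[of "D\<^sup>2 - a\<^sup>2" "3 * D\<^sup>2 - a\<^sup>2"] by linarith
      qed simp
      finally have "D\<^sup>2 * (16 * K\<^sup>2) \<le> D\<^sup>2 * (3 * D\<^sup>2 * ?S)" by (simp add: algebra_simps)
      then have "16 * K\<^sup>2 \<le> 3 * D\<^sup>2 * ?S" using pos by simp
      also have "3 * D\<^sup>2 * ?S = 16 * (sqrt 3 / 4 * D * (b + c))\<^sup>2" by (simp add: power_mult_distrib power_divide)
      finally have "K\<^sup>2 \<le> (sqrt 3 / 4 * D * (b + c))\<^sup>2" by simp
      then have K: "K \<le> sqrt 3 / 4 * D * (b + c)"
        by (rule power2_le_imp_le) (use pos in simp)
      have "K / c * (K / b) = (K / (b * c)) * K" by simp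
      also have "\<dots> \<le> (K / (b * c)) * (sqrt 3 / 4 * D * (b + c))"
        using K K0 pos by (intro mult_left_mono) auto
      also have "\<dots> = sqrt 3 / 4 * D * (K / c + K / b)"
        using pos by (simp add: field_simps)
      finally show "dist C (A + (m / c\<^sup>2) *\<^sub>R u) * dist B (A + (m / b\<^sup>2) *\<^sub>R v)
          \<le> sqrt 3 / 4 * D * (dist C (A + (m / c\<^sup>2) *\<^sub>R u) + dist B (A + (m / b\<^sup>2) *\<^sub>R v))"
        unfolding h1 h2 .
    qed (use p D0 in auto)
  qed
qed

section \<open>Triangles of taut arcs\<close>

lemma linepath_image_closed_segment:
  fixes a b :: "'a::real_normed_vector"
  shows "linepath a b ` closed_segment s t = closed_segment (linepath a b s) (linepath a b t)"
proof -
  have lp: "linepath a b u = a + u *\<^sub>R (b - a)" for u by (simp add: linepath_def algebra_simps)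
  have "linepath a b ` closed_segment s t = (+) a ` (\<lambda>u. u *\<^sub>R (b - a)) ` closed_segment s t"
    unfolding image_image lp ..
  also have "(\<lambda>u. u *\<^sub>R (b - a)) ` closed_segment s t = closed_segment (s *\<^sub>R (b - a)) (t *\<^sub>R (b - a))"
    by (rule closed_segment_linear_image[symmetric]) (simp add: linear_scaleR_left)
  finally show ?thesis unfolding lp closed_segment_translation .
qed

lemma inner_const_on_segment:
  assumes "x \<in> closed_segment A B" "inner n A = \<kappa>" "inner n B = \<kappa>"
  shows "inner n x = \<kappa>"
proof -
  obtain u where "x = (1 - u) *\<^sub>R A + u *\<^sub>R B" using assms(1) by (auto simp: in_segment)
  then have "inner n x = (1 - u) * \<kappa> + u * \<kappa>" using assms(2,3) by (simp add: inner_add_right)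
  then show ?thesis by (simp add: algebra_simps)
qed

lemma open_subset_triangle_side:
  fixes A B C :: "real^2"
  assumes "open U" "U \<subseteq> convex hull {A, B, C}"
  obtains n \<kappa> where "inner n A = \<kappa>" "inner n B = \<kappa>" "\<kappa> \<le> inner n C" "\<And>x. x \<in> U \<Longrightarrow> \<kappa> < inner n x"
proof -
  obtain n0 :: "real^2" where n0: "n0 \<noteq> 0" "inner (B - A) n0 = 0"
    using orthogonal_to_vector_exists[of "B - A"] by (auto simp: orthogonal_def)
  define n where "n = (if inner n0 (C - A) \<ge> 0 then n0 else - n0)"
  have n: "n \<noteq> 0" "inner n B = inner n A" "inner n A \<le> inner n C"
    using n0 unfolding n_def by (auto simp: inner_diff_right inner_diff_left inner_commute)
  have "convex hull {A, B, C} \<subseteq> {x. inner n x \<ge> inner n A}"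
    using n by (intro hull_minimal) (auto simp: convex_halfspace_ge)
  then have "U \<subseteq> interior {x. inner n x \<ge> inner n A}"
    using assms by (intro interior_maximal) auto
  then have "U \<subseteq> {x. inner n x > inner n A}" using n(1) by simp
  then show ?thesis using that[of n "inner n A"] n by auto
qed

lemma open_subset_triangle_misses_side:
  fixes A B C :: "real^2"
  assumes "open U" "U \<subseteq> convex hull {A, B, C}" "q \<in> closed_segment A B"
  shows "q \<notin> U"
proof
  assume "q \<in> U"
  obtain n \<kappa> where n: "inner n A = \<kappa>" "inner n B = \<kappa>" "\<And>x. x \<in> U \<Longrightarrow> \<kappa> < inner n x"
    using open_subset_triangle_side[OF assms(1,2)] by metis
  have "inner n q = \<kappa>" using inner_const_on_segment[OF assms(3) n(1,2)] .
  then show False using n(3)[OF \<open>q \<in> U\<close>] by simp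
qed

context planar_domain begin

text \<open>The curve of the three sides lies in the hull of its corners \<open>A\<close>, \<open>B\<close>, \<open>C\<close>, that is, \<open>b\<close> and \<open>c\<close> bend
into the Euclidean triangle. Hence a straight walk from \<open>p\<close> to a point of the segment \<open>A B\<close> or \<open>A C\<close>
starts inside the curve and has left it when it arrives; it meets \<open>b\<close> or \<open>c\<close> on the way.\<close>

lemma straight_triangle:
  assumes b: "taut J b" "pathstart b = A" "pathfinish b = C"
    and c: "taut J c" "pathstart c = A" "pathfinish c = B"
    and seg: "closed_segment B C \<subseteq> J"
    and int: "path_image b \<inter> path_image c \<subseteq> {A}" "path_image c \<inter> closed_segment B C \<subseteq> {B}"
      "path_image b \<inter> closed_segment B C \<subseteq> {C}"
    and p: "p \<in> open_segment B C" and q: "q \<in> closed_segment A B \<union> closed_segment A C"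
  obtains q' where "q' \<in> path_image b \<union> path_image c" "closed_segment p q' \<subseteq> J" "dist p q' \<le> dist p q"
proof -
  have "B \<noteq> C" using p by auto
  have arcs: "arc b" "arc c" using b c by (auto simp: taut_def)
  let ?c = "c +++ linepath B C +++ reversepath b"
  have c1: "simple_path ?c"
    using arcs b c int \<open>B \<noteq> C\<close>
    by (intro simple_path_join3I) (auto simp: arc_reversepath)
  have c2: "pathfinish ?c = pathstart ?c" using b c by simp
  define S where "S = path_image ?c"
  have S: "S = path_image b \<union> path_image c \<union> closed_segment B C"
    unfolding S_def using b c by (auto simp: path_image_join)
  have SJ: "S \<subseteq> J" using b c seg unfolding S taut_def by auto
  have clS: "closed S" unfolding S_def using c1 by (simp add: closed_simple_path_image)
  define U where "U = inside S"
  have op: "open U" unfolding U_def using clS by (rule open_inside)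
  have ne: "U \<noteq> {}" and fr: "frontier U = S"
    unfolding U_def S_def using Jordan_inside_frontier[OF c1 c2] by auto
  have "S \<union> U \<subseteq> convex hull {A, B, C}"
    unfolding S_def U_def
  proof (rule Jordan_curve_in_hull_of_corners[where F = "{path_image b, path_image c, closed_segment B C}"])
    show "path_image ?c = \<Union> {path_image b, path_image c, closed_segment B C}"
      using S unfolding S_def by auto
  qed (use c1 c2 SJ S_def b c int arcs in
      \<open>auto simp: straight_in_taut straight_in_convex closed_arc_image\<close>)
  then have UH: "U \<subseteq> convex hull {A, B, C}" by simp
  have UJ: "U \<subseteq> J" unfolding U_def using SJ by (rule inside_subset_domain)
  have qU: "q \<notin> U"
    using q open_subset_triangle_misses_side[OF op, of A B C q] open_subset_triangle_misses_side[OF op, of A C B q] UH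
    by (auto simp: insert_commute)
  obtain n \<kappa> where n: "inner n B = \<kappa>" "inner n C = \<kappa>" "\<kappa> \<le> inner n A" "\<And>x. x \<in> U \<Longrightarrow> \<kappa> < inner n x"
    using open_subset_triangle_side[OF op, of B C A] UH by (metis insert_commute)
  have nA: "\<kappa> < inner n A"
  proof (rule ccontr)
    assume "\<not> ?thesis"
    then have "convex hull {A, B, C} \<subseteq> {x. inner n x \<le> \<kappa>}"
      using n by (intro hull_minimal) (auto simp: convex_halfspace_le)
    then show False using ne UH n(4) by force
  qed
  have nseg: "inner n x = \<kappa>" if "x \<in> closed_segment B C" for x
    using inner_const_on_segment[OF that n(1,2)] .
  have pBC: "p \<in> closed_segment B C" "p \<noteq> B" "p \<noteq> C" using p by (auto simp: open_segment_def)
  show ?thesis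
  proof (cases "inner n q \<le> \<kappa>")
    case True
    \<comment> \<open>A target on the line \<open>B C\<close> can only be \<open>B\<close> or \<open>C\<close>, and both belong to the arcs.\<close>
    have "q = X" if X: "q \<in> closed_segment A X" "inner n X = \<kappa>" for X
    proof -
      obtain s where s: "0 \<le> s" "s \<le> 1" "q = (1 - s) *\<^sub>R A + s *\<^sub>R X" using X(1) by (auto simp: in_segment)
      have "inner n q = \<kappa> + (1 - s) * (inner n A - \<kappa>)"
        unfolding s(3) using that(2) by (simp add: inner_simps algebra_simps)
      then have "(1 - s) * (inner n A - \<kappa>) \<le> 0" using True by simp
      then have "s = 1" using nA s by (simp add: mult_le_0_iff)
      then show ?thesis using s(3) by simp
    qed
    then have "q = B \<or> q = C" using q n by blast
    then have "q \<in> path_image b \<union> path_image c" "q \<in> closed_segment B C"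
      using b c by (auto simp: pathfinish_in_path_image)
    moreover have "closed_segment p q \<subseteq> J"
      using calculation(2) pBC(1) seg by (metis closed_segment_subset convex_closed_segment order.trans)
    ultimately show ?thesis using that by blast
  next
    case False
    have "p \<notin> path_image b \<union> path_image c" using int pBC by auto
    moreover have "closed (path_image b \<union> path_image c)" using arcs by (auto simp: closed_arc_image)
    ultimately obtain \<epsilon> where eps: "\<epsilon> > 0" "ball p \<epsilon> \<inter> (path_image b \<union> path_image c) = {}"
      by (metis open_Compl ComplI openE disjoint_eq_subset_Compl)
    define H where "H = ball p \<epsilon> \<inter> {x. \<kappa> < inner n x}"
    have "H \<inter> S = {}" using eps(2) nseg unfolding H_def S by force
    have "p \<in> closure U" using pBC(1) fr S unfolding frontier_def by blast
    then obtain u where u: "u \<in> U" "u \<in> ball p \<epsilon>"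
      using eps(1) open_Int_closure_eq_empty[of "ball p \<epsilon>" U] by (metis centre_in_ball disjoint_iff open_ball)
    then have "u \<in> H" using n(4) unfolding H_def by simp
    have "convex H" unfolding H_def by (intro convex_Int convex_ball convex_halfspace_gt)
    \<comment> \<open>The open half disk on the side of \<open>A\<close> misses the curve, so it is inside as a whole.\<close>
    have HU: "H \<subseteq> U"
    proof
      fix x assume "x \<in> H"
      then have "connected_component (- S) u x"
        using convex_connected[OF \<open>convex H\<close>] \<open>u \<in> H\<close> \<open>H \<inter> S = {}\<close>
        unfolding connected_component_def by blast
      then show "x \<in> U" using inside_same_component[of S u x] u(1) unfolding U_def by blast
    qed
    define w where "w = q - p"
    have nw: "inner n w > 0" using False nseg[OF pBC(1)] unfolding w_def by (simp add: inner_diff_right)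
    then have "w \<noteq> 0" by auto
    define t0 where "t0 = min 1 (\<epsilon> / (2 * norm w))"
    have t0: "0 < t0" "t0 \<le> 1" "t0 * norm w < \<epsilon>"
      using eps(1) \<open>w \<noteq> 0\<close> unfolding t0_def by (auto simp: min_def field_simps)
    have inH: "p + t *\<^sub>R w \<in> H" if "0 < t" "t \<le> t0" for t
    proof -
      have "t * norm w < \<epsilon>" using that t0 mult_right_mono[of t t0 "norm w"] by simp
      then show ?thesis using that nw nseg[OF pBC(1)] unfolding H_def by (simp add: dist_norm inner_simps)
    qed
    have "p + t0 *\<^sub>R w \<in> interior U" using inH[of t0] t0 HU op by (auto simp: interior_open)
    moreover have "bounded U" using UJ compact_J bounded_subset compact_imp_bounded by blast
    ultimately obtain d where d: "0 < d" "p + t0 *\<^sub>R w + d *\<^sub>R w \<in> frontier U"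
      "\<And>e. \<lbrakk>0 \<le> e; e < d\<rbrakk> \<Longrightarrow> p + t0 *\<^sub>R w + e *\<^sub>R w \<in> interior U"
      using ray_to_frontier \<open>w \<noteq> 0\<close> by blast
    have inU: "p + t *\<^sub>R w \<in> U" if "t0 \<le> t" "t < t0 + d" for t
      using d(3)[of "t - t0"] that op by (simp add: interior_open algebra_simps)
    have "t0 + d \<le> 1"
    proof (rule ccontr)
      assume "\<not> ?thesis"
      then have "p + 1 *\<^sub>R w \<in> U" using t0 by (intro inU) auto
      then show False using qU unfolding w_def by simp
    qed
    define q' where "q' = p + (t0 + d) *\<^sub>R w"
    have q'S: "q' \<in> S" using d(2) fr unfolding q'_def by (simp add: algebra_simps)
    have "inner n q' > \<kappa>" using nw nseg[OF pBC(1)] t0 d unfolding q'_def by (simp add: inner_simps)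
    then have 1: "q' \<in> path_image b \<union> path_image c" using q'S nseg unfolding S by force
    have 2: "closed_segment p q' \<subseteq> J"
    proof
      fix x assume "x \<in> closed_segment p q'"
      then obtain s where s: "0 \<le> s" "s \<le> 1" "x = (1 - s) *\<^sub>R p + s *\<^sub>R q'" by (auto simp: in_segment)
      define r where "r = s * (t0 + d)"
      have x: "x = p + r *\<^sub>R w" unfolding s(3) q'_def r_def by (simp add: algebra_simps)
      have r: "0 \<le> r" "r \<le> t0 + d" using s t0 d unfolding r_def by (auto simp: mult_left_le_one_le)
      consider "r = 0" | "0 < r" "r \<le> t0" | "t0 \<le> r" "r < t0 + d" | "r = t0 + d" using r by linarith
      then show "x \<in> J"
      proof cases
        case 1 then show ?thesis using x pBC seg by auto
      next
        case 2 then show ?thesis using x inH HU UJ by blast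
      next
        case 3 then show ?thesis using x inU UJ by blast
      next
        case 4 then show ?thesis using x q'S SJ unfolding q'_def by auto
      qed
    qed
    have "dist p q' = (t0 + d) * norm w" using t0 d unfolding q'_def by (simp add: dist_norm)
    also have "\<dots> \<le> dist p q"
      using \<open>t0 + d \<le> 1\<close> t0 d unfolding w_def by (simp add: dist_norm norm_minus_commute mult_left_le_one_le)
    finally show ?thesis using that 1 2 by blast
  qed
qed

text \<open>Shorten the chord through \<open>p\<close> until it meets the two arcs only at its ends. It cuts off, at the vertex
\<open>A\<close>, a triangle with one straight side through \<open>p\<close>. All corners are points of \<open>J\<close>, so the bound for
Euclidean triangles applies with the diameter of \<open>J\<close>.\<close>

lemma point_near_taut_triangle_vertex:
  assumes b: "taut J b" "pathstart b = A" "pathfinish b = C"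
    and c: "taut J c" "pathstart c = A" "pathfinish c = B"
    and bc: "path_image b \<inter> path_image c \<subseteq> {A}"
    and p: "p \<in> closed_segment B' C'" "B' \<in> path_image c" "C' \<in> path_image b" "closed_segment B' C' \<subseteq> J"
    and pnot: "p \<notin> path_image b \<union> path_image c"
  obtains q where "q \<in> path_image b \<union> path_image c" "closed_segment p q \<subseteq> J"
    "dist p q \<le> sqrt 3 / 4 * diameter J"
proof -
  note result = that
  let ?K = "path_image b \<union> path_image c"
  have arcs: "arc b" "arc c" and inJ: "path_image b \<subseteq> J" "path_image c \<subseteq> J"
    using b c by (auto simp: taut_def)
  have "closed ?K" using arcs by (auto simp: closed_arc_image)
  obtain t where t: "t \<in> {0..1}" "p = linepath B' C' t"
    using p(1) by (metis imageE linepath_image_01)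
  have "B' \<noteq> C'" using p pnot by auto
  obtain s r where sr: "0 \<le> s" "s < t" "t < r" "r \<le> 1" "linepath B' C' s \<in> ?K" "linepath B' C' r \<in> ?K"
    "\<And>u. s < u \<Longrightarrow> u < r \<Longrightarrow> linepath B' C' u \<notin> ?K"
    using maximal_gap[of "linepath B' C'" ?K t] p t pnot \<open>closed ?K\<close>
    by (auto simp: linepath_0' linepath_1')
  define Y Z where "Y = linepath B' C' s" and "Z = linepath B' C' r"
  have seg: "closed_segment Y Z = linepath B' C' ` {s..r}"
    using linepath_image_closed_segment[of B' C' s r] sr unfolding Y_def Z_def
    by (simp add: closed_segment_eq_real_ivl)
  have segJ: "closed_segment Y Z \<subseteq> J"
  proof -
    have "linepath B' C' ` {s..r} \<subseteq> linepath B' C' ` {0..1}" using sr by (intro image_mono) auto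
    then show ?thesis using p(4) unfolding seg linepath_image_01 by blast
  qed
  have segK: "x \<in> {Y, Z}" if x: "x \<in> closed_segment Y Z" "x \<in> ?K" for x
  proof -
    obtain u where "x = linepath B' C' u" "s \<le> u" "u \<le> r" using x(1) unfolding seg by auto
    then show ?thesis using sr(7)[of u] x(2) unfolding Y_def Z_def by (cases "u = s"; cases "u = r") auto
  qed
  have pseg: "p \<in> closed_segment Y Z" unfolding seg t(2) using sr by auto
  have YZ: "Y \<in> ?K" "Z \<in> ?K" using sr unfolding Y_def Z_def by auto
  have notboth: "\<not> (Y \<in> G \<and> Z \<in> G)" if "G = path_image b \<or> G = path_image c" for G
  proof
    assume "Y \<in> G \<and> Z \<in> G"
    moreover have "straight_in J G" using that b c straight_in_taut by auto
    ultimately have "p \<in> G" using segJ pseg unfolding straight_in_def by blast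
    then show False using pnot that by blast
  qed
  have main: thesis if Y: "Y' \<in> path_image c" "Z' \<in> path_image b" "Y' \<notin> path_image b" "Z' \<notin> path_image c"
    "closed_segment Y' Z' = closed_segment Y Z" "{Y, Z} = {Y', Z'}" for Y' Z'
  proof -
    obtain \<sigma> \<tau> where st: "\<sigma> \<in> {0..1}" "\<tau> \<in> {0..1}" "Y' = c \<sigma>" "Z' = b \<tau>"
      using Y unfolding path_image_def by blast
    have AA: "A = c 0" "A = b 0" using b c by (auto simp: pathstart_def)
    have "A \<in> path_image b" "A \<in> path_image c" using b(2) c(2) by (metis pathstart_in_path_image)+
    then have "Y' \<noteq> A" "Z' \<noteq> A" using Y by auto
    then have ne: "\<sigma> \<noteq> 0" "\<tau> \<noteq> 0" using st AA by auto
    let ?c = "subpath 0 \<sigma> c" and ?b = "subpath 0 \<tau> b"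
    have sub: "path_image ?c \<subseteq> path_image c" "path_image ?b \<subseteq> path_image b"
      using st by (simp_all add: path_image_subpath_subset)
    have k: "v = Y' \<or> v = Z'" if "v \<in> closed_segment Y' Z'" "v \<in> ?K" for v
    proof -
      have "v \<in> {Y, Z}" using segK that Y(5) by blast
      then show ?thesis using Y(6) by blast
    qed
    have "p \<noteq> Y'" "p \<noteq> Z'" using pnot Y by auto
    then have "p \<in> open_segment Y' Z'" using pseg Y(5) unfolding open_segment_def by blast
    have "\<exists>q \<in> closed_segment A Y' \<union> closed_segment A Z'. dist p q \<le> sqrt 3 / 4 * diameter J"
    proof (rule triangle_bound)
      show "p \<in> closed_segment Y' Z'" using pseg Y(5) by blast
      have "A \<in> J" "Y' \<in> J" "Z' \<in> J" using \<open>A \<in> path_image b\<close> Y inJ by auto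
      then show "dist A Y' \<le> diameter J" "dist A Z' \<le> diameter J" "dist Y' Z' \<le> diameter J"
        using diameter_bounded_bound[OF compact_imp_bounded[OF compact_J]] by auto
    qed
    then obtain q where q: "q \<in> closed_segment A Y' \<union> closed_segment A Z'" "dist p q \<le> sqrt 3 / 4 * diameter J" by blast
    obtain q' where "q' \<in> path_image ?b \<union> path_image ?c" "closed_segment p q' \<subseteq> J" "dist p q' \<le> dist p q"
    proof (rule straight_triangle[of ?b A Z' ?c Y' p q])
      show "taut J ?b" "taut J ?c" using b c st ne by (auto intro!: taut_subpath)
      show "path_image ?b \<inter> path_image ?c \<subseteq> {A}" using sub bc by blast
      show "closed_segment Y' Z' \<subseteq> J" using segJ Y(5) by blast
      show "path_image ?c \<inter> closed_segment Y' Z' \<subseteq> {Y'}" "path_image ?b \<inter> closed_segment Y' Z' \<subseteq> {Z'}"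
        using k sub Y(1-4) by fast+
    qed (use st AA q \<open>p \<in> open_segment Y' Z'\<close> in auto)
    then show thesis using result[of q'] q(2) sub by (meson Un_iff order.trans subsetD)
  qed
  have "Y \<in> path_image c \<and> Z \<in> path_image b \<and> Y \<notin> path_image b \<and> Z \<notin> path_image c
     \<or> Z \<in> path_image c \<and> Y \<in> path_image b \<and> Z \<notin> path_image b \<and> Y \<notin> path_image c"
    using YZ notboth by blast
  then show thesis
    using main[of Y Z] main[of Z Y] closed_segment_commute[of Y Z] insert_commute[of Y Z "{}"] by blast
qed

text \<open>The sides of a geodesic triangle may share initial pieces. Around \<open>p\<close>, cut out of \<open>a\<close> the stretch that
avoids the other sides; by uniqueness its ends are on different sides. Following one of these sides up to its
first meeting with the other one gives a genuine Jordan triangle with \<open>p\<close> on it, hence in the closure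
of its inside, and a chord through \<open>p\<close> between the two other sides.\<close>

lemma point_near_taut_triangle:
  assumes a: "taut J a" "pathstart a = x" "pathfinish a = y"
    and b: "taut J b" "pathstart b = y" "pathfinish b = z"
    and c: "taut J c" "pathstart c = z" "pathfinish c = x"
    and p: "p \<in> path_image a"
  obtains q where "q \<in> path_image b \<union> path_image c" "closed_segment p q \<subseteq> J"
    "dist p q \<le> sqrt 3 / 4 * diameter J"
proof (cases "p \<in> path_image b \<union> path_image c")
  case True
  have "0 \<le> diameter J" using compact_J by (intro diameter_ge_0 compact_imp_bounded)
  then show ?thesis using that[of p] True p a by (auto simp: taut_def)
next
  case False
  note result = that
  let ?K = "path_image b \<union> path_image c"
  have arcs: "arc a" "arc b" "arc c" and inJ: "path_image a \<subseteq> J" "path_image b \<subseteq> J" "path_image c \<subseteq> J"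
    using a b c by (auto simp: taut_def)
  obtain t where t: "t \<in> {0..1}" "p = a t" using p unfolding path_image_def by blast
  obtain s r where sr: "0 \<le> s" "s < t" "t < r" "r \<le> 1" "a s \<in> ?K" "a r \<in> ?K"
    "\<And>u. s < u \<Longrightarrow> u < r \<Longrightarrow> a u \<notin> ?K"
  proof (rule maximal_gap[of a ?K t])
    show "continuous_on {0..1} a" using arcs by (simp add: arc_def path_def)
    show "closed ?K" using arcs by (auto simp: closed_arc_image)
    show "a 0 \<in> ?K" "a 1 \<in> ?K" using a b c
      by (metis UnCI pathfinish_in_path_image pathstart_def, metis UnCI pathstart_in_path_image pathfinish_def)
  qed (use t False in auto)
  let ?a = "subpath s r a"
  have ta: "taut J ?a" using a sr by (intro taut_subpath) auto
  have ima: "path_image ?a = a ` {s..r}" using sr by (simp add: path_image_subpath)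
  have pa: "p \<in> path_image ?a" unfolding ima using t sr by auto
  have notboth: "\<not> (a s \<in> path_image g \<and> a r \<in> path_image g)" if "g = b \<or> g = c" for g
    using taut_path_within[OF ta, of g] that b c pa False by auto
  have aK: "u \<in> {a s, a r}" if "u \<in> path_image ?a" "u \<in> ?K" for u
    using that sr(7) unfolding ima by (force simp: le_less)
  have main: thesis if gh: "taut J g" "taut J h" "path_image g \<union> path_image h = ?K"
    "a s \<in> path_image h" "a s \<notin> path_image g" "a r \<in> path_image g" "a r \<notin> path_image h"
    "pathfinish h \<in> path_image g" for g h
  proof -
    have ag: "arc g" "arc h" using gh by (auto simp: taut_def)
    obtain \<sigma> where s: "\<sigma> \<in> {0..1}" "h \<sigma> = a s" using gh(4) unfolding path_image_def by auto
    \<comment> \<open>\<open>h \<tau>\<close> is the first point of \<open>g\<close> on \<open>h\<close> after \<open>a s\<close>; it is the third vertex of the Jordan triangle.\<close>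
    define Z where "Z = {\<sigma>..1} \<inter> h -` path_image g"
    have "closed Z" unfolding Z_def using ag s
      by (intro continuous_closed_preimage) (auto simp: arc_def path_def closed_arc_image intro: continuous_on_subset)
    then have "compact Z" unfolding Z_def by (metis Int_assoc Int_absorb compact_Icc compact_Int_closed)
    moreover have "1 \<in> Z" using gh(8) s unfolding Z_def by (auto simp: pathfinish_def)
    ultimately obtain \<tau> where tau: "\<tau> \<in> Z" "\<And>u. u \<in> Z \<Longrightarrow> \<tau> \<le> u"
      using compact_attains_inf[of Z] by blast
    have "\<sigma> \<noteq> \<tau>" using tau(1) s gh(5) unfolding Z_def by auto
    then have st: "\<sigma> < \<tau>" "\<tau> \<le> 1" "h \<tau> \<in> path_image g" using tau unfolding Z_def by auto
    obtain \<rho> where rho: "\<rho> \<in> {0..1}" "g \<rho> = h \<tau>" using st(3) unfolding path_image_def by auto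
    obtain \<pi> where pi: "\<pi> \<in> {0..1}" "g \<pi> = a r" using gh(6) unfolding path_image_def by auto
    have "h \<tau> \<in> path_image h" using st s unfolding path_image_def by auto
    then have "h \<tau> \<noteq> a r" using gh(7) by metis
    then have "\<rho> \<noteq> \<pi>" using rho pi by auto
    let ?h = "subpath \<tau> \<sigma> h" and ?g = "subpath \<rho> \<pi> g"
    have th: "taut J ?h" "taut J ?g"
      using gh s st rho pi \<open>\<rho> \<noteq> \<pi>\<close> by (auto intro!: taut_subpath)
    have sub: "path_image ?h \<subseteq> path_image h" "path_image ?g \<subseteq> path_image g"
      using s st rho pi by (simp_all add: path_image_subpath_subset)
    have hg: "path_image ?h \<inter> path_image g \<subseteq> {h \<tau>}"
    proof
      fix v assume v: "v \<in> path_image ?h \<inter> path_image g"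
      then obtain u where u: "v = h u" "\<sigma> \<le> u" "u \<le> \<tau>" using st by (auto simp: path_image_subpath)
      then have "u \<in> Z" using v st unfolding Z_def by auto
      then show "v \<in> {h \<tau>}" using tau(2) u by force
    qed
    have aS: "path_image ?a \<inter> path_image ?h \<subseteq> {a s}" "path_image ?a \<inter> path_image ?g \<subseteq> {a r}"
      using aK sub gh by blast+
    let ?c = "?h +++ ?a +++ reversepath ?g"
    have c1: "simple_path ?c"
      using th ta s pi rho hg sub aS
      by (intro simple_path_join3I) (auto simp: arc_reversepath taut_def)
    have c2: "pathfinish ?c = pathstart ?c" using rho by simp
    have S: "path_image ?c = path_image ?a \<union> path_image ?g \<union> path_image ?h"
      using s pi by (auto simp: path_image_join)
    have "p \<in> frontier (inside (path_image ?c))"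
      using pa S Jordan_inside_frontier(2)[OF c1 c2] by blast
    then have "p \<in> closure (inside (path_image ?c))" unfolding frontier_def by blast
    moreover have "compact (path_image ?c)" using c1 by (simp add: compact_simple_path_image)
    moreover have "path_image ?c \<subseteq> J" using th ta unfolding S taut_def by auto
    moreover have "closed (path_image ?a)" "closed (path_image ?g)" "closed (path_image ?h)"
      using th ta by (auto simp: taut_def closed_arc_image)
    ultimately obtain B' C' where BC: "B' \<in> path_image ?h" "C' \<in> path_image ?g"
      "p \<in> closed_segment B' C'" "closed_segment B' C' \<subseteq> J"
      using chord_through_limit_point[of "path_image ?c", OF _ _ S] straight_in_taut[OF ta]
        straight_in_taut[OF th(1)] straight_in_taut[OF th(2)] by metis
    show thesis
    proof (rule point_near_taut_triangle_vertex[of ?g "h \<tau>" "a r" ?h "a s" p B' C'])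
      show "path_image ?g \<inter> path_image ?h \<subseteq> {h \<tau>}" using hg sub by blast
      show "p \<notin> path_image ?g \<union> path_image ?h" using False sub gh(3) by blast
    next
      fix q assume "q \<in> path_image ?g \<union> path_image ?h" "closed_segment p q \<subseteq> J" "dist p q \<le> sqrt 3 / 4 * diameter J"
      then show thesis using result[of q] sub gh(3) by blast
    qed (use th BC s pi rho in auto)
  qed
  have "a s \<in> path_image c \<and> a s \<notin> path_image b \<and> a r \<in> path_image b \<and> a r \<notin> path_image c
     \<or> a s \<in> path_image b \<and> a s \<notin> path_image c \<and> a r \<in> path_image c \<and> a r \<notin> path_image b"
    using sr(5,6) notboth by blast
  moreover have "z \<in> path_image b" "z \<in> path_image c"
    using b c pathfinish_in_path_image pathstart_in_path_image by metis+
  moreover have "taut J (reversepath c)" using c by (simp add: taut_reversepath)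
  ultimately show thesis
    using main[where g = b and h = "reversepath c"] main[where g = "reversepath c" and h = b] b c
    by (auto simp: Un_commute)
qed

end

section \<open>Lipschitz curves\<close>

text \<open>A curve of length at most \<open>L\<close>, up to parametrisation. In this form curves can be concatenated and
passed to limits without any computation of lengths.\<close>

definition lipschitz_joined :: "'a::metric_space set \<Rightarrow> real \<Rightarrow> 'a \<Rightarrow> 'a \<Rightarrow> bool" where
  "lipschitz_joined J L x y \<longleftrightarrow> 0 \<le> L \<and>
     (\<exists>\<phi>. 1-lipschitz_on {0..L} \<phi> \<and> \<phi> ` {0..L} \<subseteq> J \<and> \<phi> 0 = x \<and> \<phi> L = y)"

lemma lipschitz_joined_subpath:
  assumes \<phi>: "1-lipschitz_on {0..L} \<phi>" "\<phi> ` {0..L} \<subseteq> J" and st: "0 \<le> s" "s \<le> t" "t \<le> L"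
  shows "lipschitz_joined J (t - s) (\<phi> s) (\<phi> t)"
proof -
  have "1-lipschitz_on {0..t - s} (\<lambda>r. \<phi> (s + r))"
  proof (rule lipschitz_onI)
    fix r r' assume "r \<in> {0..t - s}" "r' \<in> {0..t - s}"
    then show "dist (\<phi> (s + r)) (\<phi> (s + r')) \<le> 1 * dist r r'"
      using lipschitz_onD[OF \<phi>(1), of "s + r" "s + r'"] st by auto
  qed simp
  then show ?thesis
    unfolding lipschitz_joined_def using st \<phi>(2) by (intro conjI exI[of _ "\<lambda>r. \<phi> (s + r)"]) auto
qed

lemma lipschitz_joined_refl: "\<lbrakk>x \<in> J; 0 \<le> L\<rbrakk> \<Longrightarrow> lipschitz_joined J L x x"
  unfolding lipschitz_joined_def by (intro conjI exI[of _ "\<lambda>_. x"] lipschitz_onI) auto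

lemma lipschitz_joined_sym: 
  assumes "lipschitz_joined J L x y" shows "lipschitz_joined J L y x"
proof -
  obtain \<phi> where \<phi>: "0 \<le> L" "1-lipschitz_on {0..L} \<phi>" "\<phi> ` {0..L} \<subseteq> J" "\<phi> 0 = x" "\<phi> L = y"
    using assms unfolding lipschitz_joined_def by blast
  have "1-lipschitz_on {0..L} (\<lambda>r. \<phi> (L - r))"
  proof (rule lipschitz_onI)
    fix s t assume "s \<in> {0..L}" "t \<in> {0..L}"
    then show "dist (\<phi> (L - s)) (\<phi> (L - t)) \<le> 1 * dist s t"
      using lipschitz_onD[OF \<phi>(2), of "L - s" "L - t"] by (auto simp: dist_real_def)
  qed simp
  then show ?thesis
    unfolding lipschitz_joined_def using \<phi> by (intro conjI exI[of _ "\<lambda>r. \<phi> (L - r)"]) auto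
qed

lemma lipschitz_joined_trans:
  assumes "lipschitz_joined J L x y" "lipschitz_joined J M y z"
  shows "lipschitz_joined J (L + M) x z"
proof -
  obtain \<phi> where \<phi>: "0 \<le> L" "1-lipschitz_on {0..L} \<phi>" "\<phi> ` {0..L} \<subseteq> J" "\<phi> 0 = x" "\<phi> L = y"
    using assms unfolding lipschitz_joined_def by blast
  obtain \<psi> where \<psi>: "0 \<le> M" "1-lipschitz_on {0..M} \<psi>" "\<psi> ` {0..M} \<subseteq> J" "\<psi> 0 = y" "\<psi> M = z"
    using assms unfolding lipschitz_joined_def by blast
  let ?c = "\<lambda>r. if r \<le> L then \<phi> r else \<psi> (r - L)"
  have "1-lipschitz_on {L..L + M} (\<lambda>r. \<psi> (r - L))"
  proof (rule lipschitz_onI)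
    fix s t assume "s \<in> {L..L + M}" "t \<in> {L..L + M}"
    then show "dist (\<psi> (s - L)) (\<psi> (t - L)) \<le> 1 * dist s t"
      using lipschitz_onD[OF \<psi>(2), of "s - L" "t - L"] by (auto simp: dist_real_def)
  qed simp
  then have "1-lipschitz_on {0..L + M} ?c"
    using \<phi> \<psi> by (intro lipschitz_on_concat) auto
  moreover have "?c ` {0..L + M} \<subseteq> J" using \<phi>(3) \<psi>(3) by auto
  moreover have "?c (L + M) = z" using \<phi> \<psi> by (cases "M = 0") auto
  ultimately show ?thesis
    unfolding lipschitz_joined_def using \<phi> \<psi> by (intro conjI exI[of _ ?c]) auto
qed

lemma lipschitz_joined_in: "lipschitz_joined J L x y \<Longrightarrow> x \<in> J \<and> y \<in> J"
  unfolding lipschitz_joined_def by force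

lemma lipschitz_joined_dist_le:
  assumes "lipschitz_joined J L x y" shows "dist x y \<le> L"
proof -
  obtain \<phi> where \<phi>: "0 \<le> L" "1-lipschitz_on {0..L} \<phi>" "\<phi> 0 = x" "\<phi> L = y"
    using assms unfolding lipschitz_joined_def by blast
  then show ?thesis using lipschitz_onD[OF \<phi>(2), of 0 L] by (simp add: dist_real_def)
qed

lemma lipschitz_joined_segment:
  fixes x y :: "'a::real_normed_vector"
  assumes "closed_segment x y \<subseteq> J" shows "lipschitz_joined J (dist x y) x y"
proof (cases "x = y")
  case True then show ?thesis using assms by (simp add: lipschitz_joined_refl)
next
  case False
  let ?v = "sgn (y - x)" and ?p = "\<lambda>r. x + r *\<^sub>R sgn (y - x)"
  have "1-lipschitz_on {0..dist x y} ?p"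
  proof (rule lipschitz_onI)
    fix s t :: real
    have "norm (s *\<^sub>R ?v - t *\<^sub>R ?v) = \<bar>s - t\<bar>"
      using False by (simp add: norm_sgn flip: scaleR_diff_left)
    then show "dist (?p s) (?p t) \<le> 1 * dist s t" by (simp add: dist_norm)
  qed simp
  moreover have "?p (dist x y) = y"
    using False by (simp add: sgn_div_norm dist_norm norm_minus_commute)
  moreover have "?p ` {0..dist x y} \<subseteq> closed_segment x y"
  proof safe
    fix r assume r: "r \<in> {0..dist x y}"
    have "?p r = (1 - r / dist x y) *\<^sub>R x + (r / dist x y) *\<^sub>R y"
      by (simp add: sgn_div_norm dist_norm norm_minus_commute algebra_simps divide_inverse)
    then show "?p r \<in> closed_segment x y"
      unfolding in_segment using r False by (intro exI[of _ "r / dist x y"]) auto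
  qed
  ultimately show ?thesis
    unfolding lipschitz_joined_def using assms by (intro conjI exI[of _ ?p]) auto
qed

text \<open>Arzela--Ascoli for the curves rescaled to \<open>{0..1}\<close>.\<close>

lemma lipschitz_joined_limit:
  fixes J :: "'a::euclidean_space set"
  assumes J: "compact J" and L: "0 \<le> L" and approx: "\<And>\<epsilon>. 0 < \<epsilon> \<Longrightarrow> lipschitz_joined J (L + \<epsilon>) x y"
  shows "lipschitz_joined J L x y"
proof -
  define M where "M n = L + 1 / real (Suc n)" for n
  have M: "0 < M n" "M n \<le> L + 1" for n using L by (auto simp: M_def add_nonneg_pos)
  have "\<exists>\<phi>. 1-lipschitz_on {0..M n} \<phi> \<and> \<phi> ` {0..M n} \<subseteq> J \<and> \<phi> 0 = x \<and> \<phi> (M n) = y" for n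
    using approx[of "1 / real (Suc n)"] unfolding lipschitz_joined_def M_def by simp
  then obtain \<phi> where \<phi>: "\<And>n. 1-lipschitz_on {0..M n} (\<phi> n)" "\<And>n. \<phi> n ` {0..M n} \<subseteq> J"
    "\<And>n. \<phi> n 0 = x" "\<And>n. \<phi> n (M n) = y" by metis
  define F where "F n t = \<phi> n (M n * t)" for n and t :: real
  have in_dom: "M n * t \<in> {0..M n}" if "t \<in> {0..1}" for n t
    using that M[of n] by (auto simp: mult_left_le)
  have FJ: "F n t \<in> J" if "t \<in> {0..1}" for n t
    using \<phi>(2)[of n] in_dom[OF that, of n] unfolding F_def by blast
  have Flip: "dist (F n s) (F n t) \<le> M n * \<bar>s - t\<bar>" if "s \<in> {0..1}" "t \<in> {0..1}" for n s t
    using lipschitz_onD[OF \<phi>(1) in_dom[OF that(1)] in_dom[OF that(2)], of n] M[of n]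
    unfolding F_def by (simp add: dist_real_def abs_mult flip: right_diff_distrib)
  obtain B where B: "\<And>z. z \<in> J \<Longrightarrow> norm z \<le> B"
    using compact_imp_bounded[OF J] unfolding bounded_iff by blast
  obtain g k where gk: "continuous_on {0..1} g" "strict_mono (k :: nat \<Rightarrow> nat)"
    "\<And>e. 0 < e \<Longrightarrow> \<exists>N. \<forall>n t. n \<ge> N \<and> t \<in> {0..1::real} \<longrightarrow> norm (F (k n) t - g t) < e"
  proof (rule Arzela_Ascoli[of "{0..1::real}" F B])
    show "norm (F n t) \<le> B" if "t \<in> {0..1}" for n t using FJ[OF that] B by blast
    fix s e :: real assume s: "s \<in> {0..1}" and e: "0 < e"
    show "\<exists>d>0. \<forall>n t. t \<in> {0..1} \<and> norm (s - t) < d \<longrightarrow> norm (F n s - F n t) < e"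
    proof (intro exI[of _ "e / (L + 1)"] conjI allI impI)
      fix n t assume t: "t \<in> {0..1} \<and> norm (s - t) < e / (L + 1)"
      have "norm (F n s - F n t) \<le> M n * \<bar>s - t\<bar>" using Flip[OF s, of t n] t by (simp add: dist_norm)
      also have "\<dots> \<le> (L + 1) * \<bar>s - t\<bar>" using M by (intro mult_right_mono) auto
      also have "\<dots> < e" using t L by (simp add: field_simps)
      finally show "norm (F n s - F n t) < e" .
    qed (use e L in auto)
  qed auto
  have lim: "(\<lambda>n. F (k n) t) \<longlonglongrightarrow> g t" if "t \<in> {0..1}" for t
    unfolding LIMSEQ_iff using gk(3) that by metis
  have gJ: "g t \<in> J" if "t \<in> {0..1}" for t
    using closed_sequentially[OF compact_imp_closed[OF J] _ lim[OF that]] FJ that by blast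
  have g01: "g 0 = x" "g 1 = y"
    using LIMSEQ_unique[OF lim[of 0]] LIMSEQ_unique[OF lim[of 1]] \<phi>(3,4) by (simp_all add: F_def)
  have "(\<lambda>n. 1 / real (Suc n)) \<longlonglongrightarrow> 0" using LIMSEQ_inverse_real_of_nat by (simp add: inverse_eq_divide)
  then have "M \<longlonglongrightarrow> L + 0" unfolding M_def by (intro tendsto_intros)
  then have Mk: "(\<lambda>n. M (k n)) \<longlonglongrightarrow> L"
    using LIMSEQ_subseq_LIMSEQ[OF _ gk(2), of M L] by (simp add: o_def)
  have glip: "dist (g s) (g t) \<le> L * \<bar>s - t\<bar>" if "s \<in> {0..1}" "t \<in> {0..1}" for s t
  proof (rule LIMSEQ_le)
    show "(\<lambda>n. dist (F (k n) s) (F (k n) t)) \<longlonglongrightarrow> dist (g s) (g t)"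
      using lim that by (intro tendsto_intros)
    show "(\<lambda>n. M (k n) * \<bar>s - t\<bar>) \<longlonglongrightarrow> L * \<bar>s - t\<bar>" using Mk by (intro tendsto_intros)
  qed (use Flip that in blast)
  show ?thesis
  proof (cases "L = 0")
    case True
    then have "x = y" using glip[of 0 1] g01 by simp
    then show ?thesis using gJ[of 0] g01 L by (simp add: lipschitz_joined_refl)
  next
    case False
    let ?p = "\<lambda>r. g (r / L)"
    have "1-lipschitz_on {0..L} ?p"
    proof (rule lipschitz_onI)
      fix s t assume "s \<in> {0..L}" "t \<in> {0..L}"
      then have "dist (?p s) (?p t) \<le> L * \<bar>s / L - t / L\<bar>" using False by (intro glip) auto
      also have "\<dots> = 1 * dist s t" using False L by (simp add: dist_real_def abs_mult flip: diff_divide_distrib)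
      finally show "dist (?p s) (?p t) \<le> 1 * dist s t" .
    qed simp
    then show ?thesis
      unfolding lipschitz_joined_def using False L gJ g01 by (intro conjI exI[of _ ?p]) auto
  qed
qed

section \<open>Length of curves\<close>

text \<open>Lengths are handled through a function \<open>\<mu>\<close> on the parameter interval whose increments dominate the
distances. Such a function bounds the length, since its increments telescope; conversely,
\<open>arc_length_function\<close> provides one.\<close>

lemma curve_length_le:
  assumes nonneg: "\<And>x y. 0 \<le> d x y"
    and \<mu>: "\<And>s t. \<lbrakk>0 \<le> s; s \<le> t; t \<le> 1\<rbrakk> \<Longrightarrow> d (g s) (g t) \<le> \<mu> t - \<mu> s"
  shows "curve_length d g \<le> ennreal (\<mu> 1 - \<mu> 0)"
  unfolding curve_length_def
proof (rule SUP_least)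
  fix ts :: "real list" assume "ts \<in> {ts. sorted ts \<and> set ts \<subseteq> {0..1}}"
  then have ts: "sorted ts" "set ts \<subseteq> {0..1}" by auto
  have in01: "0 \<le> ts ! i \<and> ts ! i \<le> 1" if "i < length ts" for i using ts(2) that nth_mem by force
  have mono: "\<mu> s \<le> \<mu> t" if "0 \<le> s" "s \<le> t" "t \<le> 1" for s t
    using \<mu>[OF that] nonneg[of "g s" "g t"] by simp
  have *: "(\<Sum>i<n. ennreal (d (g (ts ! i)) (g (ts ! Suc i)))) \<le> ennreal (\<mu> (ts ! n) - \<mu> (ts ! 0))"
    if "n < length ts" for n
    using that
  proof (induction n)
    case (Suc n)
    have le: "ts ! 0 \<le> ts ! n" "ts ! n \<le> ts ! Suc n" using Suc.prems ts(1) by (auto intro: sorted_nth_mono)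
    have "(\<Sum>i<Suc n. ennreal (d (g (ts ! i)) (g (ts ! Suc i))))
        \<le> ennreal (\<mu> (ts ! n) - \<mu> (ts ! 0)) + ennreal (\<mu> (ts ! Suc n) - \<mu> (ts ! n))"
      unfolding sum.lessThan_Suc using Suc le in01
      by (intro add_mono ennreal_leI \<mu>) auto
    also have "\<dots> = ennreal (\<mu> (ts ! Suc n) - \<mu> (ts ! 0))"
    proof -
      have "0 < length ts" "n < length ts" using Suc.prems by linarith+
      then have "\<mu> (ts ! 0) \<le> \<mu> (ts ! n)" "\<mu> (ts ! n) \<le> \<mu> (ts ! Suc n)"
        using le in01 Suc.prems by (auto intro!: mono)
      then show ?thesis by (subst ennreal_plus[symmetric]) auto
    qed
    finally show ?case .
  qed simp
  show "(\<Sum>i<length ts - 1. ennreal (d (g (ts ! i)) (g (ts ! Suc i)))) \<le> ennreal (\<mu> 1 - \<mu> 0)"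
  proof (cases "ts = []")
    case False
    then have "(\<Sum>i<length ts - 1. ennreal (d (g (ts ! i)) (g (ts ! Suc i))))
       \<le> ennreal (\<mu> (ts ! (length ts - 1)) - \<mu> (ts ! 0))" by (intro *) simp
    also have "\<dots> \<le> ennreal (\<mu> 1 - \<mu> 0)"
      using False in01[of 0] in01[of "length ts - 1"]
      by (intro ennreal_leI diff_mono mono) auto
    finally show ?thesis .
  qed simp
qed

lemma curve_length_ge: "ennreal (d (g 0) (g 1)) \<le> curve_length d g"
  unfolding curve_length_def by (rule SUP_upper2[of "[0, 1]"]) auto

text \<open>The function is the length of the initial part of the curve. Its increments dominate distances since appending
\<open>[s, t]\<close> to a partition of \<open>{0..s}\<close> adds at least the distance from \<open>g s\<close> to \<open>g t\<close>.\<close>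

lemma arc_length_function:
  assumes nonneg: "\<And>x y. 0 \<le> d x y" and len: "curve_length d g \<le> ennreal L" and L: "0 \<le> L"
  obtains \<mu> where "\<mu> 0 = 0" "\<mu> 1 \<le> L"
    "\<And>s t. \<lbrakk>0 \<le> s; s \<le> t; t \<le> 1\<rbrakk> \<Longrightarrow> d (g s) (g t) \<le> \<mu> t - \<mu> s"
proof -
  define P where "P ts = (\<Sum>i<length ts - 1. ennreal (d (g (ts ! i)) (g (ts ! Suc i))))" for ts
  define V where "V t = (SUP ts \<in> {ts. sorted ts \<and> set ts \<subseteq> {0..t}}. P ts)" for t :: real
  have V1: "V 1 = curve_length d g" unfolding V_def P_def curve_length_def ..
  have extend: "P ts + ennreal (d (g s) (g t)) \<le> P (ts @ [s, t])" for ts s t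
  proof -
    let ?f = "\<lambda>us i. ennreal (d (g (us ! i)) (g (us ! Suc i)))" and ?us = "ts @ [s, t]"
    have "P ts + ennreal (d (g s) (g t)) = (\<Sum>i<length ts - 1. ?f ?us i) + ?f ?us (length ts)"
      unfolding P_def by (intro arg_cong2[of _ _ _ _ "(+)"] sum.cong) (auto simp: nth_append)
    also have "\<dots> = sum (?f ?us) (insert (length ts) {..<length ts - 1})" by simp
    also have "\<dots> \<le> P ?us" unfolding P_def by (intro sum_mono2) auto
    finally show ?thesis .
  qed
  have step: "V s + ennreal (d (g s) (g t)) \<le> V t" if "0 \<le> s" "s \<le> t" for s t
  proof -
    have "V s + ennreal (d (g s) (g t))
        = (SUP ts \<in> {ts. sorted ts \<and> set ts \<subseteq> {0..s}}. P ts + ennreal (d (g s) (g t)))"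
      unfolding V_def by (rule ennreal_SUP_add_left[symmetric]) (auto intro: exI[of _ "[]"])
    also have "\<dots> \<le> V t"
    proof (rule SUP_least)
      fix ts assume ts: "ts \<in> {ts. sorted ts \<and> set ts \<subseteq> {0..s}}"
      have "ts @ [s, t] \<in> {ts. sorted ts \<and> set ts \<subseteq> {0..t}}"
        using ts that by (force simp: sorted_append)
      then have "P (ts @ [s, t]) \<le> V t" unfolding V_def by (rule SUP_upper)
      with extend show "P ts + ennreal (d (g s) (g t)) \<le> V t" by (rule order.trans)
    qed
    finally show ?thesis .
  qed
  have fin: "V t < top" "V t \<le> ennreal L" if "0 \<le> t" "t \<le> 1" for t
  proof -
    have "V t \<le> V t + ennreal (d (g t) (g 1))" by simp
    also have "\<dots> \<le> V 1" using that by (rule step)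
    finally show "V t \<le> ennreal L" using len V1 by simp
    then show "V t < top" using ennreal_less_top order.strict_trans1 by blast
  qed
  define \<mu> where "\<mu> t = enn2real (V t) - enn2real (V 0)" for t
  show ?thesis
  proof (rule that[of \<mu>])
    have "enn2real (V 1) \<le> L" using fin[of 1] L by (intro enn2real_leI) auto
    then show "\<mu> 1 \<le> L" unfolding \<mu>_def using enn2real_nonneg[of "V 0"] by linarith
    fix s t :: real assume st: "0 \<le> s" "s \<le> t" "t \<le> 1"
    have "ennreal (enn2real (V s) + d (g s) (g t)) \<le> ennreal (enn2real (V t))"
      using step[OF st(1,2)] fin[of s] fin[of t] st nonneg by simp
    then have "enn2real (V s) + d (g s) (g t) \<le> enn2real (V t)"
      by (simp add: ennreal_le_iff)
    then show "d (g s) (g t) \<le> \<mu> t - \<mu> s" unfolding \<mu>_def by simp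
  qed (simp add: \<mu>_def)
qed

text \<open>Reparametrisation by \<open>\<tau> r = Sup {t. \<mu> t \<le> r}\<close>. The function \<open>\<mu>\<close> may jump, but right of \<open>\<tau> r\<close> it exceeds
\<open>r\<close>, and arbitrarily close left of \<open>\<tau> r'\<close> it is at most \<open>r'\<close>. So continuity of \<open>g\<close> suffices to see that \<open>g \<circ> \<tau>\<close> is
Lipschitz.\<close>

lemma rectifiable_imp_lipschitz_joined:
  fixes g :: "real \<Rightarrow> 'a::metric_space"
  assumes g: "continuous_on {0..1} g" "g ` {0..1} \<subseteq> J" and len: "curve_length dist g \<le> ennreal L" and L: "0 \<le> L"
  shows "lipschitz_joined J L (g 0) (g 1)"
proof -
  obtain \<mu> where \<mu>: "\<mu> 0 = 0" "\<mu> 1 \<le> L"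
    "\<And>s t. \<lbrakk>0 \<le> s; s \<le> t; t \<le> 1\<rbrakk> \<Longrightarrow> dist (g s) (g t) \<le> \<mu> t - \<mu> s"
    using arc_length_function[OF zero_le_dist len L] by metis
  define T where "T r = {t \<in> {0..1}. \<mu> t \<le> r}" for r
  define \<tau> where "\<tau> r = Sup (T r)" for r
  have T0: "0 \<in> T r" if "0 \<le> r" for r using that \<mu>(1) unfolding T_def by simp
  have bdd: "bdd_above (T r)" for r unfolding T_def by (auto intro: bdd_aboveI[of _ 1])
  have \<tau>01: "\<tau> r \<in> {0..1}" if "0 \<le> r" for r
  proof -
    have "0 \<le> Sup (T r)" using T0[OF that] bdd by (rule cSup_upper)
    moreover have "Sup (T r) \<le> 1"
    proof (rule cSup_least)
      show "T r \<noteq> {}" using T0[OF that] by blast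
    qed (simp add: T_def)
    ultimately show ?thesis unfolding \<tau>_def by simp
  qed
  have below: "\<exists>t\<in>T r. \<tau> r - \<delta> < t \<and> t \<le> \<tau> r" if r: "0 \<le> r" "0 < \<delta>" for r \<delta>
  proof -
    have "\<tau> r - \<delta> < Sup (T r)" using r unfolding \<tau>_def by simp
    then obtain t where "t \<in> T r" "\<tau> r - \<delta> < t"
      using less_cSup_iff[OF _ bdd, of r] T0[OF r(1)] by blast
    then show ?thesis using cSup_upper[OF _ bdd, of t r] unfolding \<tau>_def by blast
  qed
  have near: "\<exists>\<delta>>0. \<forall>u\<in>{0..1}. \<bar>u - t\<bar> < \<delta> \<longrightarrow> dist (g u) (g t) < \<epsilon>" if "t \<in> {0..1}" "0 < \<epsilon>" for t \<epsilon>
    using g(1) that unfolding continuous_on_iff dist_real_def by blast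
  have lip: "dist (g (\<tau> r)) (g (\<tau> r')) \<le> r' - r" if r: "0 \<le> r" "r \<le> r'" for r r'
  proof (cases "\<tau> r < \<tau> r'")
    case False
    have "T r \<subseteq> T r'" using r unfolding T_def by auto
    then have "\<tau> r \<le> \<tau> r'" unfolding \<tau>_def using T0[OF r(1)] bdd by (intro cSup_subset_mono) auto
    then show ?thesis using False r by simp
  next
    case True
    show ?thesis
    proof (rule field_le_epsilon)
      fix \<epsilon> :: real assume "0 < \<epsilon>"
      then have e: "0 < \<epsilon> / 2" by simp
      have in01: "\<tau> r \<in> {0..1}" "\<tau> r' \<in> {0..1}" using \<tau>01 r by auto
      obtain \<delta>1 where d1: "\<delta>1 > 0" "\<And>u. u \<in> {0..1} \<Longrightarrow> \<bar>u - \<tau> r\<bar> < \<delta>1 \<Longrightarrow> dist (g u) (g (\<tau> r)) < \<epsilon> / 2"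
        using near[OF in01(1) e] by blast
      obtain \<delta>2 where d2: "\<delta>2 > 0" "\<And>u. u \<in> {0..1} \<Longrightarrow> \<bar>u - \<tau> r'\<bar> < \<delta>2 \<Longrightarrow> dist (g u) (g (\<tau> r')) < \<epsilon> / 2"
        using near[OF in01(2) e] by blast
      define h where "h = (\<tau> r' - \<tau> r) / 2"
      have h: "h > 0" using True unfolding h_def by simp
      define t where "t = \<tau> r + min h \<delta>1 / 2"
      obtain t' where t': "t' \<in> T r'" "\<tau> r' - min h \<delta>2 < t'" "t' \<le> \<tau> r'"
        using below[of r' "min h \<delta>2"] r h d2(1) by auto
      have tt: "\<tau> r < t" "t < t'" "\<bar>t - \<tau> r\<bar> < \<delta>1" "\<bar>t' - \<tau> r'\<bar> < \<delta>2" "t' \<le> 1"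
        using t' h d1(1) in01 unfolding t_def h_def min_def by (auto split: if_splits simp: field_simps)
      have t0: "0 \<le> t" using in01 tt by auto
      have "t \<notin> T r" using tt(1) cSup_upper[OF _ bdd, of t r] unfolding \<tau>_def by auto
      then have "\<mu> t > r" using tt t0 unfolding T_def by auto
      moreover have "\<mu> t' \<le> r'" using t'(1) unfolding T_def by simp
      ultimately have "dist (g t) (g t') \<le> r' - r" using \<mu>(3)[of t t'] tt t0 by simp
      moreover have "dist (g t) (g (\<tau> r)) < \<epsilon> / 2" "dist (g t') (g (\<tau> r')) < \<epsilon> / 2"
        using d1(2)[of t] d2(2)[of t'] tt t0 by auto
      ultimately show "dist (g (\<tau> r)) (g (\<tau> r')) \<le> r' - r + \<epsilon>"
        using dist_triangle[of "g (\<tau> r)" "g (\<tau> r')" "g t"] dist_triangle[of "g t" "g (\<tau> r')" "g t'"]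
        by (simp add: dist_commute)
    qed
  qed
  have start: "g (\<tau> 0) = g 0"
  proof (rule ccontr)
    assume "g (\<tau> 0) \<noteq> g 0"
    then have "0 < dist (g 0) (g (\<tau> 0))" by simp
    then obtain \<delta> where d: "\<delta> > 0" "\<And>u. u \<in> {0..1} \<Longrightarrow> \<bar>u - \<tau> 0\<bar> < \<delta> \<Longrightarrow> dist (g u) (g (\<tau> 0)) < dist (g 0) (g (\<tau> 0))"
      using near[OF \<tau>01[of 0]] by blast
    obtain t where t: "t \<in> T 0" "\<tau> 0 - \<delta> < t" "t \<le> \<tau> 0" using below[of 0 \<delta>] d(1) by auto
    then have "dist (g 0) (g t) \<le> \<mu> t" "\<mu> t \<le> 0" using \<mu>(1) \<mu>(3)[of 0 t] unfolding T_def by auto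
    then have "g t = g 0" by (metis dist_le_zero_iff order.trans)
    moreover have "dist (g t) (g (\<tau> 0)) < dist (g 0) (g (\<tau> 0))" using t by (intro d(2)) (auto simp: T_def)
    ultimately show False by simp
  qed
  have "1 \<in> T L" using \<mu>(2) unfolding T_def by simp
  then have finish: "\<tau> L = 1"
    using cSup_upper[OF _ bdd, of 1 L] \<tau>01[OF L] unfolding \<tau>_def by auto
  have "1-lipschitz_on {0..L} (g \<circ> \<tau>)"
  proof (rule lipschitz_onI)
    fix r r' assume "r \<in> {0..L}" "r' \<in> {0..L}"
    then show "dist ((g \<circ> \<tau>) r) ((g \<circ> \<tau>) r') \<le> 1 * dist r r'"
      using lip[of r r'] lip[of r' r] by (cases "r \<le> r'") (auto simp: dist_real_def dist_commute)
  qed simp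
  moreover have "(g \<circ> \<tau>) ` {0..L} \<subseteq> J" using g(2) \<tau>01 by auto
  ultimately show ?thesis
    unfolding lipschitz_joined_def using L start finish by (intro conjI exI[of _ "g \<circ> \<tau>"]) auto
qed

lemma lipschitz_joined_imp_curve:
  assumes "lipschitz_joined J L x y"
  obtains g where "euclidean_curve_in J x y g" "curve_length dist g \<le> ennreal L"
proof -
  obtain \<phi> where \<phi>: "0 \<le> L" "1-lipschitz_on {0..L} \<phi>" "\<phi> ` {0..L} \<subseteq> J" "\<phi> 0 = x" "\<phi> L = y"
    using assms unfolding lipschitz_joined_def by blast
  let ?g = "\<lambda>t. \<phi> (L * t)"
  have in_dom: "L * t \<in> {0..L}" if "t \<in> {0..1}" for t using that \<phi>(1) by (auto simp: mult_left_le)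
  have "continuous_on {0..1} ?g"
    using in_dom by (intro continuous_on_compose2[OF lipschitz_on_continuous_on[OF \<phi>(2)]] continuous_intros) auto
  then have "euclidean_curve_in J x y ?g"
    unfolding euclidean_curve_in_def path_def path_image_def pathstart_def pathfinish_def
    using \<phi> in_dom by auto
  moreover have "curve_length dist ?g \<le> ennreal (L * 1 - L * 0)"
  proof (rule curve_length_le)
    fix s t :: real assume "0 \<le> s" "s \<le> t" "t \<le> 1"
    then show "dist (?g s) (?g t) \<le> L * t - L * s"
      using lipschitz_onD[OF \<phi>(2) in_dom in_dom, of s t] \<phi>(1) mult_left_mono[of s t L]
      by (simp add: dist_real_def)
  qed simp
  ultimately show ?thesis using that by simp
qed

lemma curve_imp_lipschitz_joined:
  assumes "euclidean_curve_in J x y g" "curve_length dist g \<le> ennreal L" "0 \<le> L"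
  shows "lipschitz_joined J L x y"
  using rectifiable_imp_lipschitz_joined[of g J L] assms
  unfolding euclidean_curve_in_def path_def path_image_def pathstart_def pathfinish_def by auto

lemma length_metric_le:
  assumes "lipschitz_joined J L x y" shows "length_metric J x y \<le> L"
proof -
  obtain g where "euclidean_curve_in J x y g" "curve_length dist g \<le> ennreal L"
    using lipschitz_joined_imp_curve[OF assms] .
  then have "(INF g \<in> {g. euclidean_curve_in J x y g}. curve_length dist g) \<le> ennreal L"
    by (intro INF_lower2) auto
  then show ?thesis
    unfolding length_metric_def using assms by (intro enn2real_leI) (auto simp: lipschitz_joined_def)
qed

lemma length_metric_attained:
  assumes J: "compact J" and "lipschitz_joined J L x y"
  shows "lipschitz_joined J (length_metric J x y) x y"
proof (rule lipschitz_joined_limit[OF J])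
  let ?I = "INF g \<in> {g. euclidean_curve_in J x y g}. curve_length dist g"
  show nn: "0 \<le> length_metric J x y" unfolding length_metric_def by simp
  obtain g where "euclidean_curve_in J x y g" "curve_length dist g \<le> ennreal L"
    using lipschitz_joined_imp_curve[OF assms(2)] .
  then have "?I \<le> ennreal L" by (intro INF_lower2) auto
  then have fin: "?I < top" using ennreal_less_top order.strict_trans1 by blast
  fix \<epsilon> :: real assume e: "0 < \<epsilon>"
  have "?I < ennreal (length_metric J x y + \<epsilon>)"
    using fin e nn unfolding length_metric_def
    by (metis ennreal_enn2real ennreal_less_iff enn2real_nonneg less_add_same_cancel1)
  then obtain h where "euclidean_curve_in J x y h" "curve_length dist h < ennreal (length_metric J x y + \<epsilon>)"
    unfolding INF_less_iff by blast
  then show "lipschitz_joined J (length_metric J x y + \<epsilon>) x y"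
    using nn e by (intro curve_imp_lipschitz_joined) auto
qed

text \<open>The value of \<^const>\<open>length_metric\<close> at pairs that no rectifiable curve joins matters because the
symmetry of a metric is demanded on the whole type.\<close>

lemma length_metric_not_joined:
  assumes "\<nexists>L. lipschitz_joined J L x y" shows "length_metric J x y = 0"
proof -
  have "curve_length dist g = top" if g: "euclidean_curve_in J x y g" for g
  proof (rule ccontr)
    assume "curve_length dist g \<noteq> top"
    then have "curve_length dist g = ennreal (enn2real (curve_length dist g))"
      by (simp add: top.not_eq_extremum)
    then show False using curve_imp_lipschitz_joined[OF g _ enn2real_nonneg] assms by (metis order_refl)
  qed
  then have "(INF g \<in> {g. euclidean_curve_in J x y g}. curve_length dist g) = top"
    by (simp add: INF_top_conv)
  then show ?thesis unfolding length_metric_def by simp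
qed

lemma length_metric_commute: "length_metric J x y = length_metric J y x" if J: "compact J"
proof (cases "\<exists>L. lipschitz_joined J L x y")
  case True
  then show ?thesis
    using length_metric_attained[OF J] length_metric_le lipschitz_joined_sym by (metis order_antisym)
next
  case False
  then show ?thesis using length_metric_not_joined lipschitz_joined_sym by metis
qed

section \<open>Finite-distance points\<close>

text \<open>By invariance of domain every homeomorphism from the disk maps the open disk onto the topological interior.
Since a Jordan domain has no holes, its frontier encloses nothing but this interior.\<close>

lemma jordan_domain_topology:
  assumes "jordan_domain J"
  shows "compact J" "connected (- J)" "jordan_interior J = interior J"
    "jordan_boundary J = frontier J" "connected (interior J)" "interior J \<noteq> {}"
proof -
  let ?D = "cball 0 1 :: (real^2) set"
  have hom: "J homeomorphic ?D" using assms unfolding jordan_domain_def .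
  show cJ: "compact J" using homeomorphic_compactness[OF hom] by simp
  show conn: "connected (- J)"
    by (rule connected_complement_homeomorphic_convex_compact[OF hom]) auto
  have int: "h ` ball 0 1 = interior J" if "homeomorphism ?D J h k" for h k :: "real^2 \<Rightarrow> real^2"
  proof
    have hk: "continuous_on ?D h" "continuous_on J k" "\<And>x. x \<in> ?D \<Longrightarrow> k (h x) = x"
      "\<And>y. y \<in> J \<Longrightarrow> h (k y) = y" "h ` ?D = J" "k ` J = ?D"
      using that unfolding homeomorphism_def by auto
    have sub: "ball 0 1 \<subseteq> ?D" by (rule ball_subset_cball)
    have "open (h ` ball 0 1)"
    proof (rule invariance_of_domain)
      show "continuous_on (ball 0 1) h" using hk(1) sub by (rule continuous_on_subset)
      show "inj_on h (ball 0 1)" using hk(3) sub by (metis inj_on_inverseI subsetD)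
    qed simp
    then show "h ` ball 0 1 \<subseteq> interior J" using hk(5) sub by (intro interior_maximal) blast+
    have "open (k ` interior J)"
    proof (rule invariance_of_domain)
      show "continuous_on (interior J) k" using hk(2) interior_subset by (rule continuous_on_subset)
      show "inj_on k (interior J)" using hk(4) interior_subset by (metis inj_on_inverseI subsetD)
    qed simp
    moreover have "k ` interior J \<subseteq> ?D" using hk(6) interior_subset[of J] by blast
    ultimately have "k ` interior J \<subseteq> interior ?D" by (rule interior_maximal[rotated])
    then have kb: "k ` interior J \<subseteq> ball 0 1" by simp
    show "interior J \<subseteq> h ` ball 0 1"
    proof
      fix y assume y: "y \<in> interior J"
      then have "y = h (k y)" using hk(4) interior_subset by force
      then show "y \<in> h ` ball 0 1" using kb y by blast
    qed
  qed
  have bd: "h ` sphere 0 1 = frontier J" if "homeomorphism ?D J h k" for h k :: "real^2 \<Rightarrow> real^2"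
  proof -
    have "inj_on h ?D" "h ` ?D = J" using that unfolding homeomorphism_def by (metis inj_on_inverseI, blast)
    moreover have "sphere 0 1 = ?D - ball 0 1" by auto
    ultimately have "h ` sphere 0 1 = J - h ` ball 0 1"
      using inj_on_image_set_diff[of h ?D ?D "ball 0 1"] by auto
    then show ?thesis
      using int[OF that] cJ unfolding frontier_def by (simp add: compact_imp_closed)
  qed
  obtain h k where hk: "homeomorphism ?D J h k"
    using hom homeomorphic_sym unfolding homeomorphic_def by blast
  show b: "jordan_boundary J = frontier J"
    unfolding jordan_boundary_def using bd hk by blast
  have "frontier J \<subseteq> J" using cJ by (simp add: compact_imp_closed frontier_subset_closed)
  then have "inside (frontier J) \<subseteq> J"
    using planar_domain.inside_subset_domain[of J "frontier J"] cJ conn by (simp add: planar_domain_def)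
  then have "inside (frontier J) \<subseteq> interior J"
    using inside_no_overlap[of "frontier J"] closure_subset[of J] unfolding frontier_def by blast
  then show "jordan_interior J = interior J"
    using interior_inside_frontier[OF compact_imp_bounded[OF cJ]] unfolding jordan_interior_def b by blast
  have "continuous_on (ball 0 1) h"
    using hk continuous_on_subset[OF _ ball_subset_cball] unfolding homeomorphism_def by blast
  then have "connected (h ` ball 0 1)" by (intro connected_continuous_image) auto
  then show "connected (interior J)" using int[OF hk] by simp
  show "interior J \<noteq> {}" using int[OF hk] by (metis ball_eq_empty image_is_empty not_one_le_zero)
qed

lemma lipschitz_joined_interior:
  fixes J :: "(real^2) set"
  assumes conn: "connected (interior J)" and xy: "x \<in> interior J" "y \<in> interior J"
  shows "\<exists>L. lipschitz_joined J L x y"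
proof (rule connected_equivalence_relation[OF conn xy])
  show "\<exists>L. lipschitz_joined J L u w"
    if "\<exists>L. lipschitz_joined J L u v" "\<exists>L. lipschitz_joined J L v w" for u v w
    using that lipschitz_joined_trans by blast
  show "\<exists>L. lipschitz_joined J L v u" if "\<exists>L. lipschitz_joined J L u v" for u v
    using that lipschitz_joined_sym by blast
  fix a assume a: "a \<in> interior J"
  then obtain e where e: "e > 0" "ball a e \<subseteq> J" using mem_interior by blast
  show "\<exists>T. openin (top_of_set (interior J)) T \<and> a \<in> T \<and> (\<forall>x\<in>T. \<exists>L. lipschitz_joined J L a x)"
  proof (intro exI[of _ "interior J \<inter> ball a e"] conjI ballI)
    fix x assume "x \<in> interior J \<inter> ball a e"
    then have "closed_segment a x \<subseteq> ball a e" using e(1) by (intro closed_segment_subset) auto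
    then show "\<exists>L. lipschitz_joined J L a x" using e(2) lipschitz_joined_segment by blast
  qed (use a e in \<open>auto simp: openin_open_Int\<close>)
qed

text \<open>Interior points are joined to each other by rectifiable curves, so it does not matter which one is
taken as base point: the finite-distance points form one class of the relation of being so joined.\<close>

lemma finite_distance_points_iff:
  assumes J: "jordan_domain J" and q: "q \<in> interior J"
  shows "p \<in> finite_distance_points J \<longleftrightarrow> (\<exists>L. lipschitz_joined J L q p)"
proof
  note top = jordan_domain_topology[OF J]
  assume "p \<in> finite_distance_points J"
  then consider "p \<in> interior J" | q' g where "q' \<in> interior J" "euclidean_curve_in J q' p g" "curve_length dist g < top"
    unfolding finite_distance_points_def top by auto
  then show "\<exists>L. lipschitz_joined J L q p"
  proof cases
    case 1 then show ?thesis using lipschitz_joined_interior[OF top(5) q] by blast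
  next
    case 2
    then have "curve_length dist g \<le> ennreal (enn2real (curve_length dist g))" by simp
    then have "lipschitz_joined J (enn2real (curve_length dist g)) q' p"
      using curve_imp_lipschitz_joined[OF 2(2)] by simp
    then show ?thesis
      using lipschitz_joined_interior[OF top(5) q 2(1)] lipschitz_joined_trans by blast
  qed
next
  note top = jordan_domain_topology[OF J]
  assume "\<exists>L. lipschitz_joined J L q p"
  then obtain L where L: "lipschitz_joined J L q p" by blast
  then obtain g where g: "euclidean_curve_in J q p g" "curve_length dist g \<le> ennreal L"
    by (rule lipschitz_joined_imp_curve)
  have "curve_length dist g < top" using g(2) ennreal_less_top order.strict_trans1 by blast
  moreover have "p \<in> interior J \<or> p \<in> frontier J"
    using lipschitz_joined_in[OF L] closure_subset unfolding frontier_def by blast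
  ultimately show "p \<in> finite_distance_points J"
    unfolding finite_distance_points_def top using g(1) q by auto
qed

section \<open>Geodesics of the length metric\<close>

lemma eq_on_segmentI:
  fixes a b w :: "'z::real_inner"
  assumes u: "0 \<le> u" "u \<le> 1" and le: "dist a w \<le> u * dist a b" "dist w b \<le> (1 - u) * dist a b"
  shows "w = (1 - u) *\<^sub>R a + u *\<^sub>R b"
proof -
  define P Q where "P = w - a" and "Q = b - w"
  let ?l = "dist a b"
  have P: "norm P \<le> u * ?l" and Q: "norm Q \<le> (1 - u) * ?l"
    using le unfolding P_def Q_def by (simp_all add: dist_norm norm_minus_commute)
  have l: "?l = norm (P + Q)" unfolding P_def Q_def by (simp add: dist_norm norm_minus_commute)
  have id: "(norm ((1 - u) *\<^sub>R P - u *\<^sub>R Q))\<^sup>2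
      = (1 - u) * (norm P)\<^sup>2 + u * (norm Q)\<^sup>2 - u * (1 - u) * (norm (P + Q))\<^sup>2"
    unfolding power2_norm_eq_inner
    by (simp add: inner_diff_left inner_diff_right inner_add_left inner_add_right inner_commute algebra_simps)
  have "(norm P)\<^sup>2 \<le> (u * ?l)\<^sup>2" "(norm Q)\<^sup>2 \<le> ((1 - u) * ?l)\<^sup>2" using P Q by (simp_all add: power_mono)
  then have "(1 - u) * (norm P)\<^sup>2 \<le> (1 - u) * (u * ?l)\<^sup>2" "u * (norm Q)\<^sup>2 \<le> u * ((1 - u) * ?l)\<^sup>2"
    using u by (auto intro: mult_left_mono)
  moreover have "(1 - u) * (u * ?l)\<^sup>2 + u * ((1 - u) * ?l)\<^sup>2 = u * (1 - u) * ?l\<^sup>2"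
    by (simp add: power2_eq_square algebra_simps)
  ultimately have "(norm ((1 - u) *\<^sub>R P - u *\<^sub>R Q))\<^sup>2 \<le> 0" unfolding id l by linarith
  then have "(1 - u) *\<^sub>R P - u *\<^sub>R Q = 0" by simp
  then show ?thesis unfolding P_def Q_def by (simp add: algebra_simps)
qed

text \<open>\<open>X\<close> is a class of points of \<open>J\<close> that are joined by rectifiable curves. Such a curve does not leave its
class, so shortest curves in \<open>J\<close> are curves in \<open>X\<close>.\<close>

locale length_space =
  fixes J X :: "(real^2) set"
  assumes compact_carrier: "compact J"
    and subset_carrier: "X \<subseteq> J"
    and joined: "\<lbrakk>x \<in> X; y \<in> X\<rbrakk> \<Longrightarrow> \<exists>L. lipschitz_joined J L x y"
    and joined_closed: "\<lbrakk>x \<in> X; lipschitz_joined J L x y\<rbrakk> \<Longrightarrow> y \<in> X"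
begin

abbreviation "d \<equiv> length_metric J"

lemma attained: "\<lbrakk>x \<in> X; y \<in> X\<rbrakk> \<Longrightarrow> lipschitz_joined J (d x y) x y"
  using joined length_metric_attained[OF compact_carrier] by blast

lemma d_nonneg: "0 \<le> d x y" unfolding length_metric_def by simp

lemma dist_le_d: "\<lbrakk>x \<in> X; y \<in> X\<rbrakk> \<Longrightarrow> dist x y \<le> d x y"
  using attained lipschitz_joined_dist_le by blast

sublocale Metric_space X d
proof
  fix x y z
  show "d x y = d y x" by (rule length_metric_commute[OF compact_carrier])
  show "d x y = 0 \<longleftrightarrow> x = y" if "x \<in> X" "y \<in> X"
  proof
    assume "d x y = 0" then show "x = y" using dist_le_d[OF that] by simp
  next
    assume "x = y"
    then have "d x y \<le> 0" using that subset_carrier by (intro length_metric_le) (auto intro: lipschitz_joined_refl)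
    then show "d x y = 0" using d_nonneg[of x y] by simp
  qed
  show "d x z \<le> d x y + d y z" if "x \<in> X" "y \<in> X" "z \<in> X"
    using that by (intro length_metric_le lipschitz_joined_trans[of J _ x y] attained)
qed (rule d_nonneg)

definition geodesic :: "real \<Rightarrow> (real \<Rightarrow> real^2) \<Rightarrow> bool" where
  "geodesic D \<phi> \<longleftrightarrow> 0 \<le> D \<and> \<phi> ` {0..D} \<subseteq> X \<and> (\<forall>s\<in>{0..D}. \<forall>t\<in>{0..D}. d (\<phi> s) (\<phi> t) = \<bar>s - t\<bar>)"

lemma geodesicI:
  assumes "0 \<le> D" "\<phi> ` {0..D} \<subseteq> X"
    and "\<And>s t. \<lbrakk>0 \<le> s; s \<le> t; t \<le> D\<rbrakk> \<Longrightarrow> d (\<phi> s) (\<phi> t) = t - s"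
  shows "geodesic D \<phi>"
  unfolding geodesic_def
proof (intro conjI ballI)
  fix s t assume "s \<in> {0..D}" "t \<in> {0..D}"
  then show "d (\<phi> s) (\<phi> t) = \<bar>s - t\<bar>"
    using assms(3)[of s t] assms(3)[of t s] commute[of "\<phi> s" "\<phi> t"] by (cases "s \<le> t") auto
qed (use assms in auto)

lemma exists_geodesic:
  assumes xy: "x \<in> X" "y \<in> X"
  obtains \<phi> where "geodesic (d x y) \<phi>" "\<phi> 0 = x" "\<phi> (d x y) = y"
proof -
  let ?D = "d x y"
  obtain \<phi> where \<phi>: "1-lipschitz_on {0..?D} \<phi>" "\<phi> ` {0..?D} \<subseteq> J" "\<phi> 0 = x" "\<phi> ?D = y"
    using attained[OF xy] unfolding lipschitz_joined_def by blast
  have sub: "lipschitz_joined J (t - s) (\<phi> s) (\<phi> t)" if "0 \<le> s" "s \<le> t" "t \<le> ?D" for s t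
    using lipschitz_joined_subpath[OF \<phi>(1,2) that] .
  have inX: "\<phi> s \<in> X" if "s \<in> {0..?D}" for s
    using joined_closed[OF xy(1), of s "\<phi> s"] sub[of 0 s] that \<phi>(3) by auto
  have "geodesic ?D \<phi>"
  proof (rule geodesicI)
    fix s t assume st: "0 \<le> s" "s \<le> t" "t \<le> ?D"
    have "d (\<phi> s) (\<phi> t) \<le> t - s" "d x (\<phi> s) \<le> s" "d (\<phi> t) y \<le> ?D - t"
      using length_metric_le[OF sub[of s t]] length_metric_le[OF sub[of 0 s]]
        length_metric_le[OF sub[of t ?D]] st \<phi>(3,4) by auto
    moreover have "?D \<le> d x (\<phi> s) + d (\<phi> s) y" "d (\<phi> s) y \<le> d (\<phi> s) (\<phi> t) + d (\<phi> t) y"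
      using triangle inX st xy by auto
    ultimately show "d (\<phi> s) (\<phi> t) = t - s" by linarith
  qed (use d_nonneg inX in auto)
  then show ?thesis using that \<phi>(3,4) by blast
qed

lemma geodesic_metric: "geodesic_metric_space X d"
  unfolding geodesic_metric_space_def
proof (intro conjI ballI)
  fix x y assume xy: "x \<in> X" "y \<in> X"
  let ?D = "d x y"
  obtain \<phi> where \<phi>: "geodesic ?D \<phi>" "\<phi> 0 = x" "\<phi> ?D = y" using exists_geodesic[OF xy] .
  let ?g = "\<lambda>t. \<phi> (?D * t)"
  have in_dom: "?D * t \<in> {0..?D}" if "t \<in> {0..1}" for t using that d_nonneg[of x y] by (auto simp: mult_left_le)
  have inX: "?g t \<in> X" if "t \<in> {0..1}" for t using \<phi>(1) in_dom[OF that] unfolding geodesic_def by blast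
  have dg: "d (?g s) (?g t) = ?D * \<bar>s - t\<bar>" if "s \<in> {0..1}" "t \<in> {0..1}" for s t
    using \<phi>(1) in_dom that d_nonneg[of x y] unfolding geodesic_def by (simp add: abs_mult flip: right_diff_distrib)
  have "pathin mtopology ?g"
    unfolding pathin_def continuous_map_to_metric
  proof (intro ballI allI impI)
    fix s \<epsilon> :: real assume s: "s \<in> topspace (top_of_set {0..1})" and e: "0 < \<epsilon>"
    have D1: "?D + 1 > 0" using d_nonneg[of x y] by linarith
    show "\<exists>U. openin (top_of_set {0..1}) U \<and> s \<in> U \<and> (\<forall>t\<in>U. ?g t \<in> mball (?g s) \<epsilon>)"
    proof (intro exI[of _ "{0..1} \<inter> ball s (\<epsilon> / (?D + 1))"] conjI ballI)
      fix t assume t: "t \<in> {0..1} \<inter> ball s (\<epsilon> / (?D + 1))"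
      then have "(?D + 1) * \<bar>s - t\<bar> < \<epsilon>" using D1 by (simp add: dist_real_def field_simps)
      moreover have "?D * \<bar>s - t\<bar> \<le> (?D + 1) * \<bar>s - t\<bar>" by (intro mult_right_mono) auto
      ultimately have "d (?g s) (?g t) < \<epsilon>" using dg[of s t] s t by simp
      then show "?g t \<in> mball (?g s) \<epsilon>" using inX s t by simp
    qed (use s e D1 in \<open>auto simp: openin_open_Int\<close>)
  qed
  then have curve: "curve_between X d x y ?g" unfolding curve_between_def using \<phi> by simp
  have "curve_length d ?g \<le> ennreal (?D * 1 - ?D * 0)"
  proof (rule curve_length_le)
    fix s t :: real assume "0 \<le> s" "s \<le> t" "t \<le> 1"
    then show "d (?g s) (?g t) \<le> ?D * t - ?D * s" using dg[of s t] by (simp add: right_diff_distrib)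
  qed (rule d_nonneg)
  moreover have "ennreal ?D \<le> curve_length d ?g" using curve_length_ge[of d ?g] \<phi> by simp
  ultimately show "\<exists>g. curve_between X d x y g \<and> curve_length d g = ennreal ?D"
    using curve by (intro exI[of _ ?g]) auto
qed (rule Metric_space_axioms)

text \<open>A shortest curve has length \<open>d x y\<close>, so no inequality between the distances of its points and the
lengths of its parts is strict. Its parametrisation may pause, but its image is that of a
geodesic.\<close>

lemma shortest_curve_geodesic:
  assumes xy: "x \<in> X" "y \<in> X" and short: "shortest_curve X d x y g"
  obtains \<phi> where "geodesic (d x y) \<phi>" "\<phi> 0 = x" "\<phi> (d x y) = y" "\<phi> ` {0..d x y} = g ` {0..1}"
proof -
  let ?D = "d x y"
  have g: "pathin mtopology g" "g 0 = x" "g 1 = y"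
    using short unfolding shortest_curve_def curve_between_def by auto
  have "curve_length d g \<le> ennreal ?D"
    using geodesic_metric xy short unfolding geodesic_metric_space_def shortest_curve_def by metis
  then obtain \<mu> where \<mu>: "\<mu> 0 = 0" "\<mu> 1 \<le> ?D"
    "\<And>s t. \<lbrakk>0 \<le> s; s \<le> t; t \<le> 1\<rbrakk> \<Longrightarrow> d (g s) (g t) \<le> \<mu> t - \<mu> s"
    using arc_length_function[of d g ?D] d_nonneg by metis
  have inX: "g t \<in> X" if "t \<in> {0..1}" for t
    using g(1) that unfolding pathin_def continuous_map_def by (auto simp: Pi_iff)
  have eq: "d (g s) (g t) = \<mu> t - \<mu> s" if "0 \<le> s" "s \<le> t" "t \<le> 1" for s t
  proof -
    have "?D \<le> d x (g s) + d (g s) y" "d (g s) y \<le> d (g s) (g t) + d (g t) y"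
      using triangle inX that xy by auto
    moreover have "d x (g s) \<le> \<mu> s" "d (g t) y \<le> \<mu> 1 - \<mu> t"
      using \<mu>(3)[of 0 s] \<mu>(3)[of t 1] \<mu>(1) g that by auto
    ultimately show ?thesis using \<mu>(2) \<mu>(3)[OF that] by linarith
  qed
  have abs_eq: "d (g s) (g t) = \<bar>\<mu> s - \<mu> t\<bar>" if "s \<in> {0..1}" "t \<in> {0..1}" for s t
  proof (cases "s \<le> t")
    case True then show ?thesis using eq[of s t] d_nonneg[of "g s" "g t"] that unfolding atLeastAtMost_iff by linarith
  next
    case False then show ?thesis
      using eq[of t s] d_nonneg[of "g t" "g s"] commute[of "g s" "g t"] that unfolding atLeastAtMost_iff by linarith
  qed
  have \<mu>1: "\<mu> 1 = ?D" using eq[of 0 1] g \<mu>(1) by simp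
  have cont: "continuous_on {0..1} \<mu>"
    unfolding continuous_on_iff
  proof (intro ballI allI impI)
    fix s e :: real assume s: "s \<in> {0..1}" and e: "0 < e"
    then obtain U where U: "openin (top_of_set {0..1}) U" "s \<in> U" "\<And>t. t \<in> U \<Longrightarrow> g t \<in> mball (g s) e"
      using g(1)[unfolded pathin_def continuous_map_to_metric] by (metis topspace_euclidean_subtopology)
    then obtain r where r: "r > 0" "ball s r \<inter> {0..1} \<subseteq> U" unfolding openin_contains_ball by blast
    have "dist (\<mu> t) (\<mu> s) < e" if "t \<in> {0..1}" "dist t s < r" for t
    proof -
      have "t \<in> U" using r that by (auto simp: dist_commute)
      then have "d (g s) (g t) < e" using U(3) by auto
      then show ?thesis using abs_eq[OF s that(1)] by (simp add: dist_real_def abs_minus_commute)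
    qed
    then show "\<exists>r>0. \<forall>t\<in>{0..1}. dist t s < r \<longrightarrow> dist (\<mu> t) (\<mu> s) < e" using r(1) by blast
  qed
  have "\<exists>t\<in>{0..1}. \<mu> t = r" if "r \<in> {0..?D}" for r
    using IVT'[of \<mu> 0 r 1] that \<mu>(1) \<mu>1 cont by auto
  then obtain T where T: "\<And>r. r \<in> {0..?D} \<Longrightarrow> T r \<in> {0..1} \<and> \<mu> (T r) = r" by metis
  have same: "g s = g t" if "s \<in> {0..1}" "t \<in> {0..1}" "\<mu> s = \<mu> t" for s t
    using abs_eq[OF that(1,2)] that inX[OF that(1)] inX[OF that(2)] by simp
  have \<mu>dom: "\<mu> t \<in> {0..?D}" if "t \<in> {0..1}" for t
    using eq[of 0 t] eq[of t 1] that d_nonneg[of "g 0" "g t"] d_nonneg[of "g t" "g 1"] \<mu>(1) \<mu>1 by auto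
  have D: "0 \<in> {0..?D}" "?D \<in> {0..?D}" using d_nonneg[of x y] by auto
  show ?thesis
  proof (rule that[of "g \<circ> T"])
    show "geodesic ?D (g \<circ> T)"
    proof (rule geodesicI)
      fix s t assume st: "0 \<le> s" "s \<le> t" "t \<le> ?D"
      then have "T s \<in> {0..1}" "T t \<in> {0..1}" "\<mu> (T s) = s" "\<mu> (T t) = t" using T[of s] T[of t] by auto
      then show "d ((g \<circ> T) s) ((g \<circ> T) t) = t - s" using abs_eq[of "T s" "T t"] st by simp
    qed (use d_nonneg inX T in auto)
    show "(g \<circ> T) 0 = x" using same[of "T 0" 0] T[OF D(1)] \<mu>(1) g by simp
    show "(g \<circ> T) ?D = y" using same[of "T ?D" 1] T[OF D(2)] \<mu>1 g by simp
    show "(g \<circ> T) ` {0..?D} = g ` {0..1}"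
    proof
      show "(g \<circ> T) ` {0..?D} \<subseteq> g ` {0..1}" using T by auto
      show "g ` {0..1} \<subseteq> (g \<circ> T) ` {0..?D}"
      proof
        fix v assume "v \<in> g ` {0..1}"
        then obtain t where t: "t \<in> {0..1}" "v = g t" by blast
        have "g (T (\<mu> t)) = g t" using same[of "T (\<mu> t)" t] T[OF \<mu>dom[OF t(1)]] t(1) by simp
        then show "v \<in> (g \<circ> T) ` {0..?D}" using \<mu>dom[OF t(1)] t(2) by (metis comp_apply imageI)
      qed
    qed
  qed
qed

text \<open>If the segment between two points of a geodesic lies in \<open>J\<close>, their length distance is the Euclidean
one. The part of the geodesic between them is then too short to deviate from the segment.\<close>

lemma geodesic_taut:
  assumes \<phi>: "geodesic D \<phi>" and D: "0 < D"
  shows "taut J (\<lambda>t. \<phi> (D * t))" "path_image (\<lambda>t. \<phi> (D * t)) = \<phi> ` {0..D}"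
proof -
  let ?g = "\<lambda>t. \<phi> (D * t)"
  have in_dom: "D * t \<in> {0..D}" if "t \<in> {0..1}" for t using that D by (auto simp: mult_left_le)
  have inX: "?g t \<in> X" if "t \<in> {0..1}" for t using \<phi> in_dom[OF that] unfolding geodesic_def by blast
  have dg: "d (?g s) (?g t) = D * \<bar>s - t\<bar>" if "s \<in> {0..1}" "t \<in> {0..1}" for s t
    using \<phi> in_dom that D unfolding geodesic_def by (simp add: abs_mult flip: right_diff_distrib)
  have dist_g: "dist (?g s) (?g t) \<le> D * \<bar>s - t\<bar>" if "s \<in> {0..1}" "t \<in> {0..1}" for s t
    using dist_le_d[OF inX inX] dg that by metis
  have "D-lipschitz_on {0..1} ?g"
    using dist_g D by (intro lipschitz_onI) (auto simp: dist_real_def)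
  then have "path ?g" unfolding path_def by (rule lipschitz_on_continuous_on)
  moreover have "inj_on ?g {0..1}"
  proof (rule inj_onI)
    fix s t assume st: "s \<in> {0..1}" "t \<in> {0..1}" "?g s = ?g t"
    then have "D * \<bar>s - t\<bar> = 0" using dg[OF st(1,2)] inX[OF st(1)] by simp
    then show "s = t" using D by simp
  qed
  ultimately have arc: "arc ?g" unfolding arc_def by blast
  show im: "path_image ?g = \<phi> ` {0..D}"
  proof -
    have "(\<lambda>t. D * t) ` {0..1} = {0..D}" using D image_mult_atLeastAtMost[of D 0 1] by simp
    then show ?thesis unfolding path_image_def by (metis image_image)
  qed
  show "taut J ?g"
    unfolding taut_def
  proof (intro conjI ballI impI subsetI)
    show "arc ?g" by fact
    show "x \<in> J" if "x \<in> path_image ?g" for x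
      using that \<phi> subset_carrier unfolding im geodesic_def by blast
  next
    fix s t z assume st: "s \<in> {0..1}" "t \<in> {0..1}" and seg: "closed_segment (?g s) (?g t) \<subseteq> J"
      and z: "z \<in> closed_segment (?g s) (?g t)"
    obtain u where u: "0 \<le> u" "u \<le> 1" "z = (1 - u) *\<^sub>R ?g s + u *\<^sub>R ?g t" using z by (auto simp: in_segment)
    let ?r = "(1 - u) * s + u * t"
    have r: "?r \<in> closed_segment s t" using u by (auto simp: in_segment)
    then have r01: "?r \<in> {0..1}" using st closed_segment_subset[of s "{0..1}" t] by auto
    have "d (?g s) (?g t) \<le> dist (?g s) (?g t)"
      using lipschitz_joined_segment[OF seg] by (rule length_metric_le)
    then have l: "D * \<bar>s - t\<bar> = dist (?g s) (?g t)" using dg[OF st] dist_g[OF st] by simp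
    have "\<bar>s - ?r\<bar> = u * \<bar>s - t\<bar>" "\<bar>?r - t\<bar> = (1 - u) * \<bar>s - t\<bar>"
    proof -
      have "s - ?r = u * (s - t)" "?r - t = (1 - u) * (s - t)" by (simp_all add: algebra_simps)
      then show "\<bar>s - ?r\<bar> = u * \<bar>s - t\<bar>" "\<bar>?r - t\<bar> = (1 - u) * \<bar>s - t\<bar>" using u by (simp_all add: abs_mult)
    qed
    then have "dist (?g s) (?g ?r) \<le> u * (D * \<bar>s - t\<bar>)" "dist (?g ?r) (?g t) \<le> (1 - u) * (D * \<bar>s - t\<bar>)"
      using dist_g[OF st(1) r01] dist_g[OF r01 st(2)] by (simp_all only: mult.left_commute)
    then have "?g ?r = z" unfolding u(3) l by (rule eq_on_segmentI[OF u(1,2)])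
    then show "z \<in> ?g ` closed_segment s t" using r by blast
  qed
qed

text \<open>A degenerate side reduces the triangle to two geodesics with common ends, which coincide.\<close>

lemma side_within_others:
  assumes conn: "connected (- J)"
    and xyz: "x \<in> X" "y \<in> X" "z \<in> X"
    and short: "shortest_curve X d x y a" "shortest_curve X d y z b" "shortest_curve X d z x c"
  shows "side_within d (sqrt 3 / 4 * diameter J) a b c"
  unfolding side_within_def
proof
  interpret planar_domain J using compact_carrier conn by unfold_locales
  let ?\<delta> = "sqrt 3 / 4 * diameter J" and ?K = "b ` {0..1} \<union> c ` {0..1}"
  have \<delta>: "0 \<le> ?\<delta>" using compact_carrier by (simp add: diameter_ge_0 compact_imp_bounded)
  fix p assume p: "p \<in> a ` {0..1}"
  obtain \<alpha> where \<alpha>: "geodesic (d x y) \<alpha>" "\<alpha> 0 = x" "\<alpha> (d x y) = y" "\<alpha> ` {0..d x y} = a ` {0..1}"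
    using shortest_curve_geodesic[OF xyz(1,2) short(1)] .
  obtain \<beta> where \<beta>: "geodesic (d y z) \<beta>" "\<beta> 0 = y" "\<beta> (d y z) = z" "\<beta> ` {0..d y z} = b ` {0..1}"
    using shortest_curve_geodesic[OF xyz(2,3) short(2)] .
  obtain \<gamma> where \<gamma>: "geodesic (d z x) \<gamma>" "\<gamma> 0 = z" "\<gamma> (d z x) = x" "\<gamma> ` {0..d z x} = c ` {0..1}"
    using shortest_curve_geodesic[OF xyz(3,1) short(3)] .
  have inX: "a ` {0..1} \<subseteq> X" "?K \<subseteq> X" using \<alpha> \<beta> \<gamma> unfolding geodesic_def by auto
  have "b 0 = y" "b 1 = z" "c 0 = z" "c 1 = x"
    using short unfolding shortest_curve_def curve_between_def by blast+
  then have ends: "y \<in> b ` {0..1}" "z \<in> b ` {0..1}" "z \<in> c ` {0..1}" "x \<in> c ` {0..1}"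
    by (metis atLeastAtMost_iff image_eqI order_refl zero_le_one)+
  let ?a = "\<lambda>t. \<alpha> (d x y * t)" and ?b = "\<lambda>t. \<beta> (d y z * t)" and ?c = "\<lambda>t. \<gamma> (d z x * t)"
  have pq: "\<exists>q\<in>?K. d p q \<le> ?\<delta>" if "p \<in> ?K"
    using that inX(2) \<delta> by (intro bexI[of _ p]) auto
  have pos: "u = v \<or> 0 < d u v" if "u \<in> X" "v \<in> X" for u v using that by auto
  consider "x = y" | "x \<noteq> y" "y = z" | "x \<noteq> y" "z = x" | "x \<noteq> y" "y \<noteq> z" "z \<noteq> x" by blast
  then have "\<exists>q\<in>?K. d p q \<le> ?\<delta>"
  proof cases
    case 1
    then have "p = x" using p \<alpha> xyz by auto
    then show ?thesis using ends pq by blast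
  next
    case 2
    have "taut J ?a" "path_image ?a = a ` {0..1}" "taut J ?c" "path_image ?c = c ` {0..1}"
      using geodesic_taut[OF \<alpha>(1)] geodesic_taut[OF \<gamma>(1)] pos[OF xyz(1,2)] pos[OF xyz(3,1)] 2 \<alpha>(4) \<gamma>(4) by auto
    then have "a ` {0..1} \<subseteq> c ` {0..1}"
      using taut_path_within[of ?a ?c] ends 2 \<alpha> unfolding pathstart_def pathfinish_def by simp
    then show ?thesis using p pq by blast
  next
    case 3
    have "taut J ?a" "path_image ?a = a ` {0..1}" "taut J ?b" "path_image ?b = b ` {0..1}"
      using geodesic_taut[OF \<alpha>(1)] geodesic_taut[OF \<beta>(1)] pos[OF xyz(1,2)] pos[OF xyz(2,3)] 3 \<alpha>(4) \<beta>(4) by auto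
    then have "a ` {0..1} \<subseteq> b ` {0..1}"
      using taut_path_within[of ?a ?b] ends 3 \<alpha> unfolding pathstart_def pathfinish_def by simp
    then show ?thesis using p pq by blast
  next
    case 4
    have t: "taut J ?a" "path_image ?a = a ` {0..1}" "taut J ?b" "path_image ?b = b ` {0..1}"
        "taut J ?c" "path_image ?c = c ` {0..1}"
      using geodesic_taut[OF \<alpha>(1)] geodesic_taut[OF \<beta>(1)] geodesic_taut[OF \<gamma>(1)]
        pos[OF xyz(1,2)] pos[OF xyz(2,3)] pos[OF xyz(3,1)] 4 \<alpha>(4) \<beta>(4) \<gamma>(4) by auto
    obtain q where q: "q \<in> path_image ?b \<union> path_image ?c" "closed_segment p q \<subseteq> J" "dist p q \<le> ?\<delta>"
    proof (rule point_near_taut_triangle[of ?a x y ?b z ?c p])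
      show "p \<in> path_image ?a" using p t(2) by simp
    qed (use t \<alpha> \<beta> \<gamma> in \<open>auto simp: pathstart_def pathfinish_def\<close>)
    have "d p q \<le> dist p q" using lipschitz_joined_segment[OF q(2)] by (rule length_metric_le)
    then have "d p q \<le> ?\<delta>" using q(3) by linarith
    moreover have "q \<in> ?K" using q(1) t by simp
    ultimately show ?thesis by blast
  qed
  then obtain q where "q \<in> ?K" "d p q \<le> ?\<delta>" by blast
  then show "(INF q \<in> ?K. d p q) \<le> ?\<delta>"
    by (intro cINF_lower2) (auto intro: bdd_belowI2[of _ 0] d_nonneg)
qed

end

section \<open>Hyperbolicity\<close>

theorem corollary3p1:
  fixes J :: "(real^2) set"
  assumes "jordan_domain J"
  shows "hyperbolic_space (finite_distance_points J) (length_metric J)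
           (sqrt 3 / 4 * diameter J)"
proof -
  note top = jordan_domain_topology[OF assms]
  obtain q where q: "q \<in> interior J" using top(6) by blast
  note X_iff = finite_distance_points_iff[OF assms q]
  interpret length_space J "finite_distance_points J"
  proof
    show "finite_distance_points J \<subseteq> J" using X_iff lipschitz_joined_in by blast
    show "\<exists>L. lipschitz_joined J L x y"
      if "x \<in> finite_distance_points J" "y \<in> finite_distance_points J" for x y
      using that lipschitz_joined_sym lipschitz_joined_trans unfolding X_iff by blast
    show "y \<in> finite_distance_points J"
      if "x \<in> finite_distance_points J" "lipschitz_joined J L x y" for x y L
      using that lipschitz_joined_trans unfolding X_iff by blast
  qed (rule top(1))
  show ?thesis
    unfolding hyperbolic_space_def geodesic_triangle_def
    using geodesic_metric side_within_others[OF top(2)] diameter_ge_0[OF compact_imp_bounded[OF top(1)]]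
    by auto
qed

end
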